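(* Let $R$ be a commutative ring and let $a\in R$ be neither a zero-divisor nor a unit. Set $\overline{R}=R/aR$. If $\mathrm{fPD}(\overline{R})<\infty$, then $\mathrm{fPD}(R)\ge \mathrm{fPD}(\overline{R})+1$.
   Context: All rings are commutative with identity. For a ring $R$, $\mathcal{FPR}(R)$ is the class of $R$-modules $M$ admitting an exact sequence $0\to P_n\to\cdots\to P_1\to P_0\to M\to 0$ (some $n\ge 0$) with every $P_i$ a finitely generated projective $R$-module. The small finitistic dimension is $\mathrm{fPD}(R)=\sup\{\mathrm{pd}_R M\mid M\in\mathcal{FPR}(R)\}$, where $\mathrm{pd}_R$ is projective dimension. *)

theory Defs
  imports "HOL-Algebra.Algebra" "HOL-Library.Extended_Nat"
begin

text \<open>
  HOL has no quantification over types inside a formula, so wherever the mathematics says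
  ``for all modules'' or ``there is a module'', the carriers have to be drawn from one fixed type.
  Each such type below is chosen large enough to contain an isomorphic copy of every module that
  matters, so that the restriction does not change the notion; the reason is given in each case.
\<close>

definition module_hom ::
  "('a, 'r) ring_scheme \<Rightarrow> ('a, 'b) module \<Rightarrow> ('a, 'c) module \<Rightarrow> ('b \<Rightarrow> 'c) set" where
  "module_hom R M N = {f \<in> carrier M \<rightarrow> carrier N.
     (\<forall>x\<in>carrier M. \<forall>y\<in>carrier M. f (x \<oplus>\<^bsub>M\<^esub> y) = f x \<oplus>\<^bsub>N\<^esub> f y) \<and>
     (\<forall>r\<in>carrier R. \<forall>x\<in>carrier M. f (r \<odot>\<^bsub>M\<^esub> x) = r \<odot>\<^bsub>N\<^esub> f x)}"

definition fin_gen :: "('a, 'r) ring_scheme \<Rightarrow> ('a, 'b) module \<Rightarrow> bool" where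
  "fin_gen R M \<longleftrightarrow> (\<exists>S. finite S \<and> S \<subseteq> carrier M \<and>
     (\<forall>x\<in>carrier M. \<exists>c \<in> S \<rightarrow> carrier R. x = (\<Oplus>\<^bsub>M\<^esub>s\<in>S. c s \<odot>\<^bsub>M\<^esub> s)))"

text \<open>
  The usual lifting property: every homomorphism from \<open>P\<close> to \<open>N\<close> lifts along every surjection
  from \<open>L\<close> to \<open>N\<close>. The carrier types of \<open>L\<close> and \<open>N\<close> lose nothing: they include
  \<open>N = P\<close> together with the free module \<open>L\<close> on the set \<open>carrier P\<close> (functions of
  finite support on \<open>carrier P\<close>). Lifting the identity of \<open>P\<close> along the canonical surjection
  from \<open>L\<close> makes \<open>P\<close> a direct summand of a free module, whence \<open>P\<close> has the lifting
  property with respect to modules over arbitrary carrier types.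
\<close>

definition projective :: "('a, 'r) ring_scheme \<Rightarrow> ('a, 'b) module \<Rightarrow> bool" where
  "projective R P \<longleftrightarrow> module R P \<and>
     (\<forall>(L :: ('a, 'b \<Rightarrow> 'a) module) (N :: ('a, 'b) module) g f.
        module R L \<and> module R N \<and>
        g \<in> module_hom R L N \<and> g ` carrier L = carrier N \<and> f \<in> module_hom R P N \<longrightarrow>
        (\<exists>h \<in> module_hom R P L. \<forall>x\<in>carrier P. g (h x) = f x))"

text \<open>
  Exactness of \<open>0 \<rightarrow> P n \<rightarrow> \<dots> \<rightarrow> P 1 \<rightarrow> P 0 \<rightarrow> M \<rightarrow> 0\<close>, where \<open>d i\<close> maps
  \<open>P (Suc i)\<close> to \<open>P i\<close> and \<open>e\<close> maps \<open>P 0\<close> to \<open>M\<close>. The sequence is continued to the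
  left by zero modules; exactness at \<open>P n\<close> then says that the map leaving \<open>P n\<close> is injective,
  for \<open>n = 0\<close> as well as for \<open>n > 0\<close>.
\<close>

definition finite_resolution ::
  "('a, 'r) ring_scheme \<Rightarrow> nat \<Rightarrow> (nat \<Rightarrow> ('a, 'p) module) \<Rightarrow> (nat \<Rightarrow> 'p \<Rightarrow> 'p) \<Rightarrow>
   ('p \<Rightarrow> 'b) \<Rightarrow> ('a, 'b) module \<Rightarrow> bool" where
  "finite_resolution R n P d e M \<longleftrightarrow>
     (\<forall>i. module R (P i)) \<and> module R M \<and>
     (\<forall>i>n. carrier (P i) = {\<zero>\<^bsub>P i\<^esub>}) \<and>
     (\<forall>i. d i \<in> module_hom R (P (Suc i)) (P i)) \<and> e \<in> module_hom R (P 0) M \<and>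
     e ` carrier (P 0) = carrier M \<and>
     d 0 ` carrier (P 1) = a_kernel (P 0) M e \<and>
     (\<forall>i. d (Suc i) ` carrier (P (Suc (Suc i))) = a_kernel (P (Suc i)) (P i) (d i))"

text \<open>
  The carrier type for the terms of resolutions of a module with carrier type \<open>'b\<close>. Let
  \<open>\<kappa>\<close> be the cardinality of the type \<open>('a + 'b) list\<close>, that is, the maximum of
  \<open>\<aleph>\<^sub>0\<close>, \<open>|'a|\<close> and \<open>|'b|\<close>. A free module on at most \<open>\<kappa>\<close> generators consists of
  finitely supported functions on a subset of \<open>('a + 'b) list\<close>, has at most \<open>\<kappa>\<close> elements, and
  so do all its submodules. Hence all syzygies of \<open>M\<close> in a free resolution built step by step have
  at most \<open>\<kappa>\<close> elements, and every module that size is (over a nontrivial ring) isomorphic to one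
  with this carrier type. So if \<open>M\<close> has a projective resolution of length \<open>n\<close> at all, then by
  Schanuel's lemma it has one over this type. A finitely generated projective module is isomorphic to
  a submodule of some \<open>R\<^sup>n\<close>, so it also occurs over this type.
\<close>

type_synonym ('a, 'b) res_carrier = "('a + 'b) list \<Rightarrow> 'a"

definition FPR :: "('a, 'r) ring_scheme \<Rightarrow> ('a, 'b) module set" where
  "FPR R = {M. \<exists>n (P :: nat \<Rightarrow> ('a, ('a, 'b) res_carrier) module) d e.
     finite_resolution R n P d e M \<and> (\<forall>i\<le>n. projective R (P i) \<and> fin_gen R (P i))}"

text \<open>The infimum of the empty set is \<open>\<infinity>\<close>, and the zero module gets dimension \<open>0\<close>.\<close>

definition pd :: "('a, 'r) ring_scheme \<Rightarrow> ('a, 'b) module \<Rightarrow> enat" where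
  "pd R M = Inf {enat n | n. \<exists>(P :: nat \<Rightarrow> ('a, ('a, 'b) res_carrier) module) d e.
     finite_resolution R n P d e M \<and> (\<forall>i\<le>n. projective R (P i))}"

text \<open>
  A module in \<open>FPR R\<close> is finitely generated, hence isomorphic to a quotient of some \<open>R\<^sup>n\<close>; the
  elements of such a quotient are sets of functions from \<open>nat\<close> to \<open>'a\<close>.
\<close>

definition fPD :: "('a, 'r) ring_scheme \<Rightarrow> enat" where
  "fPD R = (SUP M \<in> (FPR R :: ('a, (nat \<Rightarrow> 'a) set) module set). pd R M)"

definition zero_divisor :: "('a, 'r) ring_scheme \<Rightarrow> 'a \<Rightarrow> bool" where
  "zero_divisor R a \<longleftrightarrow> a \<in> carrier R \<and> (\<exists>b\<in>carrier R. b \<noteq> \<zero>\<^bsub>R\<^esub> \<and> a \<otimes>\<^bsub>R\<^esub> b = \<zero>\<^bsub>R\<^esub>)"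

end

theory Submission
  imports Defs
begin

text \<open>
  Write \<open>S = R/aR\<close> and let \<open>P\<close> be a resolution of an \<open>S\<close>-module \<open>M\<close> of minimal
  length \<open>m\<close> by finitely generated projectives. Presenting each \<open>P i\<close> as a quotient of a
  free \<open>R\<close>-module \<open>F i\<close>, with kernel \<open>K i\<close>, and lifting the differentials yields a
  resolution of \<open>M\<close> over \<open>R\<close> of length \<open>m + 1\<close> with terms \<open>F i \<times> K (i - 1)\<close>; each
  \<open>K i\<close> is projective because \<open>a\<close> is regular. If \<open>M\<close> had projective dimension at most
  \<open>m\<close> over \<open>R\<close>, then comparison with a shorter resolution would split off the last term
  \<open>K m\<close>. Dividing the splitting by \<open>a\<close> gives a retraction of \<open>P m \<rightarrow> P (m - 1)\<close> over
  \<open>S\<close>, so \<open>P\<close> could be shortened, against the choice of \<open>m\<close>. For \<open>m = 0\<close> the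
  same argument shows \<open>M = 0\<close>.
\<close>

subsection \<open>Module homomorphisms\<close>

text \<open>Dividing the splitting by \<open>a\<close> makes explicit Rees' isomorphism of
  Ext_R^(m+1)(M,N) with Ext_S^m(M,N/aN), for \<open>a\<close> regular on N; all of it is phrased by
  retractions onto cycles. Two obstacles shape the proof. The lifted differentials
  \<open>phi\<close> need not compose to zero: the composite only lands in the kernel
  \<open>K\<close>, and the second component of the differential over \<open>R\<close> absorbs this
  defect. And projective dimension is witnessed by arbitrary projectives, whereas membership in
  \<open>FPR\<close> gives finitely generated terms but no bound on the length; a resolution with
  both virtues comes from truncating the second kind by a retraction obtained from the first. The
  same truncation yields the final contradiction. Finiteness of fPD(S) makes the supremum a natural
  number \<open>m\<close>, which some module then attains; for \<open>m = 0\<close> the module taken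
  is \<open>S\<close> itself, nonzero because \<open>a\<close> is not a unit. As \<open>FPR\<close>,
  \<open>pd\<close> and \<open>fPD\<close> fix carrier types, the modules constructed are moved
  along injections into these types.\<close>

lemma module_homI:
  assumes "\<And>x. x \<in> carrier M \<Longrightarrow> f x \<in> carrier N"
    and "\<And>x y. x \<in> carrier M \<Longrightarrow> y \<in> carrier M \<Longrightarrow> f (x \<oplus>\<^bsub>M\<^esub> y) = f x \<oplus>\<^bsub>N\<^esub> f y"
    and "\<And>r x. r \<in> carrier R \<Longrightarrow> x \<in> carrier M \<Longrightarrow> f (r \<odot>\<^bsub>M\<^esub> x) = r \<odot>\<^bsub>N\<^esub> f x"
  shows "f \<in> module_hom R M N"
  using assms by (auto simp: module_hom_def)

lemma module_hom_closed: "f \<in> module_hom R M N \<Longrightarrow> x \<in> carrier M \<Longrightarrow> f x \<in> carrier N"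
  and module_hom_add: "f \<in> module_hom R M N \<Longrightarrow> x \<in> carrier M \<Longrightarrow> y \<in> carrier M \<Longrightarrow>
    f (x \<oplus>\<^bsub>M\<^esub> y) = f x \<oplus>\<^bsub>N\<^esub> f y"
  and module_hom_smult: "f \<in> module_hom R M N \<Longrightarrow> r \<in> carrier R \<Longrightarrow> x \<in> carrier M \<Longrightarrow>
    f (r \<odot>\<^bsub>M\<^esub> x) = r \<odot>\<^bsub>N\<^esub> f x"
  by (auto simp: module_hom_def)

lemma module_hom_zero:
  assumes "module R M" "module R N" "f \<in> module_hom R M N"
  shows "f \<zero>\<^bsub>M\<^esub> = \<zero>\<^bsub>N\<^esub>"
proof -
  interpret M: module R M by fact
  interpret N: module R N by fact
  have "f \<zero>\<^bsub>M\<^esub> \<oplus>\<^bsub>N\<^esub> f \<zero>\<^bsub>M\<^esub> = f \<zero>\<^bsub>M\<^esub>"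
    using module_hom_add[OF assms(3), of "\<zero>\<^bsub>M\<^esub>" "\<zero>\<^bsub>M\<^esub>"] by simp
  then show ?thesis
    using module_hom_closed[OF assms(3), of "\<zero>\<^bsub>M\<^esub>"] N.M.add.r_cancel_one' by auto
qed

lemma module_hom_uminus:
  assumes "module R M" "module R N" "f \<in> module_hom R M N" "x \<in> carrier M"
  shows "f (\<ominus>\<^bsub>M\<^esub> x) = \<ominus>\<^bsub>N\<^esub> f x"
proof -
  interpret M: module R M by fact
  interpret N: module R N by fact
  have "f (\<ominus>\<^bsub>M\<^esub> x) \<oplus>\<^bsub>N\<^esub> f x = \<zero>\<^bsub>N\<^esub>"
    using module_hom_add[OF assms(3), of "\<ominus>\<^bsub>M\<^esub> x" x] assms
    by (simp add: M.M.l_neg module_hom_zero[OF assms(1,2,3)])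
  then show ?thesis
    using module_hom_closed[OF assms(3)] assms(4) by (metis M.M.a_inv_closed N.M.minus_equality)
qed

lemma module_hom_minus:
  assumes "module R M" "module R N" "f \<in> module_hom R M N" "x \<in> carrier M" "y \<in> carrier M"
  shows "f (x \<ominus>\<^bsub>M\<^esub> y) = f x \<ominus>\<^bsub>N\<^esub> f y"
proof -
  interpret M: module R M by fact
  show ?thesis
    using assms by (simp add: a_minus_def module_hom_add[OF assms(3)] module_hom_uminus[OF assms(1,2,3)])
qed

lemma module_hom_id: "(\<lambda>x. x) \<in> module_hom R M M"
  by (rule module_homI) auto

lemma module_hom_compose:
  assumes "f \<in> module_hom R L M" "g \<in> module_hom R M N"
  shows "(\<lambda>x. g (f x)) \<in> module_hom R L N"
  by (rule module_homI)
    (simp_all add: module_hom_closed[OF assms(1)] module_hom_closed[OF assms(2)]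
      module_hom_add[OF assms(1)] module_hom_add[OF assms(2)]
      module_hom_smult[OF assms(1)] module_hom_smult[OF assms(2)])

lemma module_hom_const_zero:
  assumes "module R N"
  shows "(\<lambda>x. \<zero>\<^bsub>N\<^esub>) \<in> module_hom R M N"
proof -
  interpret N: module R N by fact
  show ?thesis by (rule module_homI) auto
qed

lemma module_hom_add_fun:
  assumes "module R N" "f \<in> module_hom R M N" "g \<in> module_hom R M N"
  shows "(\<lambda>x. f x \<oplus>\<^bsub>N\<^esub> g x) \<in> module_hom R M N"
proof -
  interpret N: module R N by fact
  note hom = module_hom_closed[OF assms(2)] module_hom_closed[OF assms(3)]
  show ?thesis
    by (rule module_homI)
      (simp_all add: hom module_hom_add[OF assms(2)] module_hom_add[OF assms(3)]
        module_hom_smult[OF assms(2)] module_hom_smult[OF assms(3)] N.smult_r_distr N.M.a_ac)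
qed

lemma module_hom_smult_fun:
  assumes "module R N" "r \<in> carrier R" "f \<in> module_hom R M N"
  shows "(\<lambda>x. r \<odot>\<^bsub>N\<^esub> f x) \<in> module_hom R M N"
proof -
  interpret N: module R N by fact
  note hom = module_hom_closed[OF assms(3)]
  show ?thesis
    using assms(2)
    by (intro module_homI)
      (simp_all add: hom module_hom_add[OF assms(3)] module_hom_smult[OF assms(3)]
        N.smult_r_distr N.smult_assoc1[symmetric] N.R.m_comm)
qed

lemma module_hom_uminus_fun:
  assumes "module R N" "f \<in> module_hom R M N"
  shows "(\<lambda>x. \<ominus>\<^bsub>N\<^esub> f x) \<in> module_hom R M N"
proof -
  interpret N: module R N by fact
  note hom = module_hom_closed[OF assms(2)]
  show ?thesis
    by (rule module_homI)
      (simp_all add: hom module_hom_add[OF assms(2)] module_hom_smult[OF assms(2)]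
        N.M.minus_add N.smult_r_minus)
qed

lemma module_hom_minus_fun:
  assumes "module R N" "f \<in> module_hom R M N" "g \<in> module_hom R M N"
  shows "(\<lambda>x. f x \<ominus>\<^bsub>N\<^esub> g x) \<in> module_hom R M N"
  unfolding a_minus_def
  by (intro module_hom_add_fun module_hom_uminus_fun assms)

lemma a_minus_eq_zero_iff:
  assumes "module R M" "x \<in> carrier M" "y \<in> carrier M"
  shows "x \<ominus>\<^bsub>M\<^esub> y = \<zero>\<^bsub>M\<^esub> \<longleftrightarrow> x = y"
proof -
  interpret M: module R M by fact
  show ?thesis
    using assms(2,3) M.M.minus_equality[of x "\<ominus>\<^bsub>M\<^esub> y"] by (auto simp: a_minus_def M.M.r_neg)
qed

text \<open>Submodules are encoded by shrinking the carrier and keeping the operations. Closure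
  under negation need not be assumed, as the inverse of \<open>x\<close> is (-1)x.\<close>

lemma module_carrier_update:
  assumes "module R M" "U \<subseteq> carrier M" "\<zero>\<^bsub>M\<^esub> \<in> U"
    and "\<And>x y. x \<in> U \<Longrightarrow> y \<in> U \<Longrightarrow> x \<oplus>\<^bsub>M\<^esub> y \<in> U"
    and "\<And>r x. r \<in> carrier R \<Longrightarrow> x \<in> U \<Longrightarrow> r \<odot>\<^bsub>M\<^esub> x \<in> U"
  shows "module R (M\<lparr>carrier := U\<rparr>)"
proof -
  interpret M: module R M by fact
  have U: "x \<in> carrier M" if "x \<in> U" for x using assms(2) that by auto
  have "\<exists>y\<in>U. y \<oplus>\<^bsub>M\<^esub> x = \<zero>\<^bsub>M\<^esub>" if x: "x \<in> U" for x
  proof (rule bexI)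
    show "(\<ominus>\<^bsub>R\<^esub> \<one>\<^bsub>R\<^esub>) \<odot>\<^bsub>M\<^esub> x \<in> U" using assms(5) x by simp
    show "(\<ominus>\<^bsub>R\<^esub> \<one>\<^bsub>R\<^esub>) \<odot>\<^bsub>M\<^esub> x \<oplus>\<^bsub>M\<^esub> x = \<zero>\<^bsub>M\<^esub>"
      using U[OF x] by (simp add: M.smult_l_minus M.M.l_neg)
  qed
  then show ?thesis
    using assms(3-5)
    by (intro moduleI abelian_groupI M.R.cring_axioms)
      (auto simp: U M.M.a_ac M.smult_l_distr M.smult_r_distr M.smult_assoc1)
qed

lemma module_kernel:
  assumes "module R M" "module R N" "f \<in> module_hom R M N"
  shows "module R (M\<lparr>carrier := {x \<in> carrier M. f x = \<zero>\<^bsub>N\<^esub>}\<rparr>)"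
proof -
  interpret M: module R M by fact
  interpret N: module R N by fact
  show ?thesis
    by (rule module_carrier_update[OF assms(1)])
      (auto simp: module_hom_zero[OF assms] module_hom_add[OF assms(3)] module_hom_smult[OF assms(3)])
qed

lemma module_hom_carrier_update_dom:
  "f \<in> module_hom R M N \<Longrightarrow> U \<subseteq> carrier M \<Longrightarrow> f \<in> module_hom R (M\<lparr>carrier := U\<rparr>) N"
  unfolding module_hom_def by (simp add: subset_iff Pi_iff)

lemma module_hom_carrier_update_cod:
  assumes "f \<in> module_hom R M N" "f ` carrier M \<subseteq> U"
  shows "f \<in> module_hom R M (N\<lparr>carrier := U\<rparr>)"
  using assms by (auto simp: module_hom_def)

text \<open>The homomorphism theorem: \<open>f\<close> is constant on the fibres of
  \<open>q\<close>, so its value at a chosen preimage does not depend on the choice, and linearity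
  follows.\<close>

lemma module_hom_factor:
  assumes "module R A" "module R B" "module R C"
    and q: "q \<in> module_hom R A B" "q ` carrier A = carrier B"
    and f: "f \<in> module_hom R A C"
    and ker: "\<And>x. x \<in> carrier A \<Longrightarrow> q x = \<zero>\<^bsub>B\<^esub> \<Longrightarrow> f x = \<zero>\<^bsub>C\<^esub>"
  obtains g where "g \<in> module_hom R B C" "\<And>x. x \<in> carrier A \<Longrightarrow> g (q x) = f x"
proof -
  interpret A: module R A by fact
  interpret B: module R B by fact
  interpret C: module R C by fact
  define g where "g = (\<lambda>y. f (inv_into (carrier A) q y))"
  have eq: "f x = f y" if "x \<in> carrier A" "y \<in> carrier A" "q x = q y" for x y
  proof -
    have "f (x \<ominus>\<^bsub>A\<^esub> y) = \<zero>\<^bsub>C\<^esub>"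
      using that module_hom_closed[OF q(1)]
      by (intro ker) (auto simp: module_hom_minus[OF assms(1,2) q(1)] a_minus_eq_zero_iff[OF assms(2)])
    then show ?thesis
      using that module_hom_closed[OF f]
      by (simp add: module_hom_minus[OF assms(1,3) f] a_minus_eq_zero_iff[OF assms(3)])
  qed
  have gq: "g (q x) = f x" if "x \<in> carrier A" for x
    unfolding g_def using that
    by (intro eq) (auto simp: inv_into_into f_inv_into_f)
  have "g \<in> module_hom R B C"
  proof (rule module_homI)
    fix y assume "y \<in> carrier B"
    then obtain x where "x \<in> carrier A" "y = q x" using q(2) by auto
    then show "g y \<in> carrier C" using gq module_hom_closed[OF f] by auto
  next
    fix y y' assume "y \<in> carrier B" "y' \<in> carrier B"
    then obtain x x' where "x \<in> carrier A" "y = q x" "x' \<in> carrier A" "y' = q x'"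
      using q(2) by (metis imageE)
    then show "g (y \<oplus>\<^bsub>B\<^esub> y') = g y \<oplus>\<^bsub>C\<^esub> g y'"
      using gq[of "x \<oplus>\<^bsub>A\<^esub> x'"] by (simp add: gq module_hom_add[OF f] module_hom_add[OF q(1)])
  next
    fix r y assume "y \<in> carrier B" and r: "r \<in> carrier R"
    then obtain x where "x \<in> carrier A" "y = q x" using q(2) by auto
    then show "g (r \<odot>\<^bsub>B\<^esub> y) = r \<odot>\<^bsub>C\<^esub> g y"
      using gq[of "r \<odot>\<^bsub>A\<^esub> x"] r by (simp add: gq module_hom_smult[OF f] module_hom_smult[OF q(1)])
  qed
  then show thesis using gq that by blast
qed

subsection \<open>Free and projective modules\<close>

text \<open>The index set may be infinite (\<open>carrier P\<close> is used below), hence the finite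
  support; coordinates outside \<open>S\<close> are forced to zero so that equality of vectors is
  equality of functions. The undefined fields are inherited by the module record from the ring
  record.\<close>

definition free_module :: "('a, 'r) ring_scheme \<Rightarrow> 's set \<Rightarrow> ('a, 's \<Rightarrow> 'a) module" where
  "free_module R S = \<lparr>carrier = {x. (\<forall>s. x s \<in> carrier R) \<and> finite {s. x s \<noteq> \<zero>\<^bsub>R\<^esub>} \<and>
       (\<forall>s. s \<notin> S \<longrightarrow> x s = \<zero>\<^bsub>R\<^esub>)},
     monoid.mult = undefined, one = undefined, ring.zero = (\<lambda>s. \<zero>\<^bsub>R\<^esub>),
     add = (\<lambda>x y s. x s \<oplus>\<^bsub>R\<^esub> y s), module.smult = (\<lambda>r x s. r \<otimes>\<^bsub>R\<^esub> x s)\<rparr>"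

definition unit_vec :: "('a, 'r) ring_scheme \<Rightarrow> 's \<Rightarrow> 's \<Rightarrow> 'a" where
  "unit_vec R s = (\<lambda>t. if t = s then \<one>\<^bsub>R\<^esub> else \<zero>\<^bsub>R\<^esub>)"

lemma free_module_simps [simp]:
  "\<zero>\<^bsub>free_module R S\<^esub> = (\<lambda>s. \<zero>\<^bsub>R\<^esub>)"
  "x \<oplus>\<^bsub>free_module R S\<^esub> y = (\<lambda>s. x s \<oplus>\<^bsub>R\<^esub> y s)"
  "r \<odot>\<^bsub>free_module R S\<^esub> x = (\<lambda>s. r \<otimes>\<^bsub>R\<^esub> x s)"
  by (simp_all add: free_module_def)

lemma mem_free_module:
  "x \<in> carrier (free_module R S) \<longleftrightarrow> (\<forall>s. x s \<in> carrier R) \<and>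
     finite {s. x s \<noteq> \<zero>\<^bsub>R\<^esub>} \<and> {s. x s \<noteq> \<zero>\<^bsub>R\<^esub>} \<subseteq> S"
  by (auto simp: free_module_def)

lemma mem_free_module_finite:
  "finite S \<Longrightarrow> x \<in> carrier (free_module R S) \<longleftrightarrow>
     (\<forall>s. x s \<in> carrier R) \<and> (\<forall>s. s \<notin> S \<longrightarrow> x s = \<zero>\<^bsub>R\<^esub>)"
  by (auto simp: mem_free_module subset_iff intro: finite_subset[of _ S])

lemma free_module_module:
  assumes "cring R"
  shows "module R (free_module R S)"
proof -
  interpret R: cring R by fact
  have add: "(\<lambda>s. x s \<oplus>\<^bsub>R\<^esub> y s) \<in> carrier (free_module R S)"
    if "x \<in> carrier (free_module R S)" "y \<in> carrier (free_module R S)" for x y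
  proof -
    have "{s. x s \<oplus>\<^bsub>R\<^esub> y s \<noteq> \<zero>\<^bsub>R\<^esub>} \<subseteq> {s. x s \<noteq> \<zero>\<^bsub>R\<^esub>} \<union> {s. y s \<noteq> \<zero>\<^bsub>R\<^esub>}" by auto
    moreover have "finite ({s. x s \<noteq> \<zero>\<^bsub>R\<^esub>} \<union> {s. y s \<noteq> \<zero>\<^bsub>R\<^esub>})"
      using that by (simp add: mem_free_module)
    ultimately show ?thesis
      using that unfolding mem_free_module by (auto intro: finite_subset)
  qed
  have smult: "(\<lambda>s. r \<otimes>\<^bsub>R\<^esub> x s) \<in> carrier (free_module R S)"
    if "r \<in> carrier R" "x \<in> carrier (free_module R S)" for r x
  proof -
    have "{s. r \<otimes>\<^bsub>R\<^esub> x s \<noteq> \<zero>\<^bsub>R\<^esub>} \<subseteq> {s. x s \<noteq> \<zero>\<^bsub>R\<^esub>}" using that by auto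
    then show ?thesis
      using that unfolding mem_free_module by (auto intro: finite_subset)
  qed
  have inv: "\<exists>y\<in>carrier (free_module R S). (\<lambda>s. y s \<oplus>\<^bsub>R\<^esub> x s) = (\<lambda>s. \<zero>\<^bsub>R\<^esub>)"
    if "x \<in> carrier (free_module R S)" for x
  proof
    show "(\<lambda>s. (\<ominus>\<^bsub>R\<^esub> \<one>\<^bsub>R\<^esub>) \<otimes>\<^bsub>R\<^esub> x s) \<in> carrier (free_module R S)" using that smult by simp
    show "(\<lambda>s. (\<ominus>\<^bsub>R\<^esub> \<one>\<^bsub>R\<^esub>) \<otimes>\<^bsub>R\<^esub> x s \<oplus>\<^bsub>R\<^esub> x s) = (\<lambda>s. \<zero>\<^bsub>R\<^esub>)"
      using that by (simp add: mem_free_module R.l_minus R.l_neg)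
  qed
  show ?thesis
    by (intro moduleI abelian_groupI assms)
      (use add smult inv in \<open>auto simp: mem_free_module R.a_ac R.l_distr R.r_distr R.m_assoc\<close>)
qed

lemma unit_vec_mem:
  assumes "cring R" "s \<in> S"
  shows "unit_vec R s \<in> carrier (free_module R S)"
proof -
  interpret R: cring R by fact
  show ?thesis using assms(2) by (auto simp: mem_free_module unit_vec_def)
qed

text \<open>Induction on a finite set containing the support, splitting off one coordinate at a time
  as a multiple of a unit vector.\<close>

lemma free_module_hom_eqI:
  assumes "cring R" "module R M"
    and f: "f \<in> module_hom R (free_module R S) M" and g: "g \<in> module_hom R (free_module R S) M"
    and basis: "\<And>s. s \<in> S \<Longrightarrow> f (unit_vec R s) = g (unit_vec R s)"
    and x: "x \<in> carrier (free_module R S)"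
  shows "f x = g x"
proof -
  interpret R: cring R by fact
  note free = free_module_module[OF assms(1), of S]
  have "f x = g x" if "finite A" "x \<in> carrier (free_module R S)" "{s. x s \<noteq> \<zero>\<^bsub>R\<^esub>} \<subseteq> A" for A x
    using that
  proof (induction A arbitrary: x)
    case empty
    then have "x = \<zero>\<^bsub>free_module R S\<^esub>" by auto
    then show ?case
      using module_hom_zero[OF free assms(2) f] module_hom_zero[OF free assms(2) g] by simp
  next
    case (insert a A)
    show ?case
    proof (cases "x a = \<zero>\<^bsub>R\<^esub>")
      case True
      then have "{s. x s \<noteq> \<zero>\<^bsub>R\<^esub>} \<subseteq> A" using insert.prems(2) by auto
      then show ?thesis using insert.IH insert.prems(1) by blast
    next
      case False
      define y where "y = x(a := \<zero>\<^bsub>R\<^esub>)"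
      have xR: "x s \<in> carrier R" for s using insert.prems(1) by (simp add: mem_free_module)
      have aS: "a \<in> S" using False insert.prems(1) by (auto simp: mem_free_module)
      have "{s. y s \<noteq> \<zero>\<^bsub>R\<^esub>} \<subseteq> {s. x s \<noteq> \<zero>\<^bsub>R\<^esub>}" by (auto simp: y_def)
      then have y: "y \<in> carrier (free_module R S)"
        using insert.prems(1) unfolding mem_free_module
        by (auto simp: y_def intro: finite_subset)
      have "f y = g y" using insert.prems(2) by (intro insert.IH y) (auto simp: y_def)
      moreover have "x = y \<oplus>\<^bsub>free_module R S\<^esub> x a \<odot>\<^bsub>free_module R S\<^esub> unit_vec R a"
        using xR by (auto simp: y_def unit_vec_def fun_eq_iff)
      moreover have "x a \<odot>\<^bsub>free_module R S\<^esub> unit_vec R a \<in> carrier (free_module R S)"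
        using module.smult_closed[OF free] xR unit_vec_mem[OF assms(1) aS] by blast
      ultimately show ?thesis
        using y basis[OF aS] xR unit_vec_mem[OF assms(1) aS]
          module_hom_add[OF f] module_hom_add[OF g] module_hom_smult[OF f] module_hom_smult[OF g]
        by metis
    qed
  qed
  then show ?thesis using x by (auto simp: mem_free_module)
qed

text \<open>This is the linear map out of the free module that extends \<open>c\<close> from the
  unit vectors. Summing over the support alone keeps the index set finite; over an infinite set
  \<open>finsum\<close> would return its default zero.\<close>

definition lin_comb :: "('a, 'r) ring_scheme \<Rightarrow> ('a, 'b) module \<Rightarrow> ('s \<Rightarrow> 'b) \<Rightarrow> ('s \<Rightarrow> 'a) \<Rightarrow> 'b" where
  "lin_comb R M c x = (\<Oplus>\<^bsub>M\<^esub>s\<in>{s. x s \<noteq> \<zero>\<^bsub>R\<^esub>}. x s \<odot>\<^bsub>M\<^esub> c s)"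

lemma lin_comb_eq:
  assumes "module R M" "c \<in> S \<rightarrow> carrier M" "x \<in> carrier (free_module R S)"
    and "finite A" "{s. x s \<noteq> \<zero>\<^bsub>R\<^esub>} \<subseteq> A" "A \<subseteq> S"
  shows "lin_comb R M c x = (\<Oplus>\<^bsub>M\<^esub>s\<in>A. x s \<odot>\<^bsub>M\<^esub> c s)"
proof -
  interpret M: module R M by fact
  have "c s \<in> carrier M" if "s \<in> A" for s using assms(2,6) that by auto
  then show ?thesis
    unfolding lin_comb_def using assms(3-5)
    by (intro M.M.add.finprod_mono_neutral_cong_left) (auto simp: mem_free_module)
qed

lemma lin_comb_hom:
  assumes "module R M" "c \<in> S \<rightarrow> carrier M"
  shows "lin_comb R M c \<in> module_hom R (free_module R S) M"
proof (rule module_homI)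
  interpret M: module R M by fact
  have c: "c s \<in> carrier M" if "s \<in> S" for s using assms(2) that by auto
  note free = free_module_module[OF M.R.cring_axioms, of S]
  interpret F: module R "free_module R S" by (rule free)
  show "lin_comb R M c x \<in> carrier M" if "x \<in> carrier (free_module R S)" for x
    unfolding lin_comb_def using that c by (intro M.M.finsum_closed) (auto simp: mem_free_module)
  show "lin_comb R M c (x \<oplus>\<^bsub>free_module R S\<^esub> y) = lin_comb R M c x \<oplus>\<^bsub>M\<^esub> lin_comb R M c y"
    if xy: "x \<in> carrier (free_module R S)" "y \<in> carrier (free_module R S)" for x y
  proof -
    \<comment> \<open>The support of a sum can be smaller than the union of the supports, so all
      three sums are taken over that union.\<close>
    define A where "A = {s. x s \<noteq> \<zero>\<^bsub>R\<^esub>} \<union> {s. y s \<noteq> \<zero>\<^bsub>R\<^esub>}"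
    have A: "finite A" "A \<subseteq> S" using xy by (auto simp: A_def mem_free_module)
    have xyR: "x s \<in> carrier R" "y s \<in> carrier R" for s using xy by (auto simp: mem_free_module)
    have "lin_comb R M c (x \<oplus>\<^bsub>free_module R S\<^esub> y)
        = (\<Oplus>\<^bsub>M\<^esub>s\<in>A. (x s \<oplus>\<^bsub>R\<^esub> y s) \<odot>\<^bsub>M\<^esub> c s)"
      by (subst lin_comb_eq[OF assms F.M.a_closed[OF xy] A(1) _ A(2)]) (auto simp: A_def)
    also have "\<dots> = (\<Oplus>\<^bsub>M\<^esub>s\<in>A. x s \<odot>\<^bsub>M\<^esub> c s \<oplus>\<^bsub>M\<^esub> y s \<odot>\<^bsub>M\<^esub> c s)"
      using xyR A c by (intro M.M.finsum_cong') (auto simp: M.smult_l_distr subset_iff)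
    also have "\<dots> = (\<Oplus>\<^bsub>M\<^esub>s\<in>A. x s \<odot>\<^bsub>M\<^esub> c s) \<oplus>\<^bsub>M\<^esub> (\<Oplus>\<^bsub>M\<^esub>s\<in>A. y s \<odot>\<^bsub>M\<^esub> c s)"
      using xyR A c by (intro M.M.finsum_addf) (auto simp: subset_iff)
    also have "\<dots> = lin_comb R M c x \<oplus>\<^bsub>M\<^esub> lin_comb R M c y"
      using lin_comb_eq[OF assms xy(1) A(1) _ A(2)] lin_comb_eq[OF assms xy(2) A(1) _ A(2)]
      by (simp add: A_def)
    finally show ?thesis .
  qed
  show "lin_comb R M c (r \<odot>\<^bsub>free_module R S\<^esub> x) = r \<odot>\<^bsub>M\<^esub> lin_comb R M c x"
    if r: "r \<in> carrier R" and x: "x \<in> carrier (free_module R S)" for r x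
  proof -
    define A where "A = {s. x s \<noteq> \<zero>\<^bsub>R\<^esub>}"
    have A: "finite A" "A \<subseteq> S" using x by (auto simp: A_def mem_free_module)
    have xR: "x s \<in> carrier R" for s using x by (auto simp: mem_free_module)
    have "lin_comb R M c (r \<odot>\<^bsub>free_module R S\<^esub> x) = (\<Oplus>\<^bsub>M\<^esub>s\<in>A. (r \<otimes>\<^bsub>R\<^esub> x s) \<odot>\<^bsub>M\<^esub> c s)"
      by (subst lin_comb_eq[OF assms F.smult_closed[OF r x] A(1) _ A(2)]) (use r in \<open>auto simp: A_def\<close>)
    also have "\<dots> = (\<Oplus>\<^bsub>M\<^esub>s\<in>A. r \<odot>\<^bsub>M\<^esub> (x s \<odot>\<^bsub>M\<^esub> c s))"
      using xR A c r by (intro M.M.finsum_cong') (auto simp: M.smult_assoc1 subset_iff)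
    also have "\<dots> = r \<odot>\<^bsub>M\<^esub> lin_comb R M c x"
      unfolding lin_comb_def A_def[symmetric] using A c r xR
      by (intro M.finsum_smult_ldistr[symmetric]) (auto simp: subset_iff)
    finally show ?thesis .
  qed
qed

lemma lin_comb_unit_vec:
  assumes "module R M" "c \<in> S \<rightarrow> carrier M" "s \<in> S"
  shows "lin_comb R M c (unit_vec R s) = c s"
proof -
  interpret M: module R M by fact
  have c: "c s \<in> carrier M" using assms by auto
  have "lin_comb R M c (unit_vec R s) = (\<Oplus>\<^bsub>M\<^esub>t\<in>{s}. unit_vec R s t \<odot>\<^bsub>M\<^esub> c t)"
    using assms(3) by (intro lin_comb_eq[OF assms(1,2) unit_vec_mem[OF M.R.cring_axioms assms(3)]])
      (auto simp: unit_vec_def)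
  also have "\<dots> = c s" using c by (simp add: unit_vec_def)
  finally show ?thesis .
qed

text \<open>Preimages under \<open>g\<close> are chosen for the images of the unit vectors and
  extended linearly; precomposing with the section \<open>i\<close> restricts the lift to
  \<open>P\<close>.\<close>

lemma retract_of_free_lift:
  assumes "module R P" "module R L" "module R N"
    and i: "i \<in> module_hom R P (free_module R S)" and p: "p \<in> module_hom R (free_module R S) P"
    and pi: "\<And>x. x \<in> carrier P \<Longrightarrow> p (i x) = x"
    and g: "g \<in> module_hom R L N" "g ` carrier L = carrier N"
    and f: "f \<in> module_hom R P N"
  shows "\<exists>h\<in>module_hom R P L. \<forall>x\<in>carrier P. g (h x) = f x"
proof -
  interpret P: module R P by fact
  have "\<forall>s\<in>S. \<exists>l\<in>carrier L. g l = f (p (unit_vec R s))"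
    using g(2) module_hom_closed[OF module_hom_compose[OF p f]]
      unit_vec_mem[OF P.R.cring_axioms] by (metis imageE)
  then obtain c where c: "\<And>s. s \<in> S \<Longrightarrow> c s \<in> carrier L"
      "\<And>s. s \<in> S \<Longrightarrow> g (c s) = f (p (unit_vec R s))"
    by metis
  have cS: "c \<in> S \<rightarrow> carrier L" using c(1) by auto
  note h = lin_comb_hom[OF assms(2) cS]
  have eq: "g (lin_comb R L c y) = f (p y)" if "y \<in> carrier (free_module R S)" for y
    by (rule free_module_hom_eqI[OF P.R.cring_axioms assms(3) module_hom_compose[OF h g(1)]
          module_hom_compose[OF p f] _ that])
      (simp add: lin_comb_unit_vec[OF assms(2) cS] c)
  show ?thesis
  proof (intro bexI[OF _ module_hom_compose[OF i h]] ballI)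
    show "g (lin_comb R L c (i x)) = f x" if "x \<in> carrier P" for x
      using eq[OF module_hom_closed[OF i that]] pi[OF that] by simp
  qed
qed

text \<open>Frees the lifting property from the carrier types in \<open>projective\<close>. The
  definition is used for one surjection only, evaluation from the free module on
  \<open>carrier P\<close>, which exhibits \<open>P\<close> as a retract.\<close>

lemma projective_lift:
  fixes P :: "('a, 'p) module" and L :: "('a, 'l) module" and N :: "('a, 'n) module"
  assumes P: "projective R P" and "module R L" "module R N"
    and "g \<in> module_hom R L N" "g ` carrier L = carrier N" "f \<in> module_hom R P N"
  shows "\<exists>h\<in>module_hom R P L. \<forall>x\<in>carrier P. g (h x) = f x"
proof -
  let ?F = "free_module R (carrier P)" and ?ev = "lin_comb R P (\<lambda>x. x)"
  have mP: "module R P" using P by (simp add: projective_def)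
  interpret P: module R P by (rule mP)
  have id: "(\<lambda>x. x) \<in> carrier P \<rightarrow> carrier P" by simp
  note ev = lin_comb_hom[OF mP id]
  have "?ev ` carrier ?F = carrier P"
  proof
    show "carrier P \<subseteq> ?ev ` carrier ?F"
      using lin_comb_unit_vec[OF mP id] unit_vec_mem[OF P.R.cring_axioms, of _ "carrier P"]
      by (metis image_eqI subsetI)
  qed (use module_hom_closed[OF ev] in auto)
  then have "\<exists>i\<in>module_hom R P ?F. \<forall>x\<in>carrier P. ?ev (i x) = x"
    using P[unfolded projective_def, THEN conjunct2, rule_format, of ?F P ?ev "\<lambda>x. x"]
      free_module_module[OF P.R.cring_axioms, of "carrier P"] mP ev module_hom_id[of R P]
    by simp
  then obtain i where i: "i \<in> module_hom R P ?F" "\<And>x. x \<in> carrier P \<Longrightarrow> ?ev (i x) = x"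
    by auto
  show ?thesis by (rule retract_of_free_lift[OF mP assms(2,3) i(1) ev i(2) assms(4-6)])
qed

lemma projective_zero:
  fixes P :: "('a, 'b) module"
  assumes "module R P" "carrier P = {\<zero>\<^bsub>P\<^esub>}"
  shows "projective R P"
  unfolding projective_def
proof (intro conjI assms(1) allI impI)
  fix L :: "('a, 'b \<Rightarrow> 'a) module" and N :: "('a, 'b) module" and g f
  assume "module R L \<and> module R N \<and> g \<in> module_hom R L N \<and> g ` carrier L = carrier N \<and> f \<in> module_hom R P N"
  then have *: "module R L" "module R N" "g \<in> module_hom R L N" "f \<in> module_hom R P N" by auto
  have "\<forall>x\<in>carrier P. g \<zero>\<^bsub>L\<^esub> = f x"
    using assms(2) module_hom_zero[OF *(1,2,3)] module_hom_zero[OF assms(1) *(2,4)] by simp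
  then show "\<exists>h\<in>module_hom R P L. \<forall>x\<in>carrier P. g (h x) = f x"
    by (intro bexI[where x = "\<lambda>x. \<zero>\<^bsub>L\<^esub>"] module_hom_const_zero[OF *(1)])
qed

text \<open>Equivalent to \<open>projective\<close> together with \<open>fin_gen\<close>, but
  without reference to auxiliary carrier types. It passes directly to retracts, products and copies,
  and its two maps are the data that the change of rings needs.\<close>

definition fg_projective :: "('a, 'r) ring_scheme \<Rightarrow> ('a, 'b) module \<Rightarrow> bool" where
  "fg_projective R P \<longleftrightarrow> module R P \<and>
     (\<exists>n. \<exists>i\<in>module_hom R P (free_module R {..<n::nat}).
        \<exists>p\<in>module_hom R (free_module R {..<n}) P. \<forall>x\<in>carrier P. p (i x) = x)"

lemma fg_projective_imp_module: "fg_projective R P \<Longrightarrow> module R P"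
  by (simp add: fg_projective_def)

lemma fg_projective_imp_projective:
  fixes P :: "('a, 'c) module"
  assumes "fg_projective R P"
  shows "projective R P"
proof -
  from assms obtain n i p where *: "module R P" "i \<in> module_hom R P (free_module R {..<n::nat})"
      "p \<in> module_hom R (free_module R {..<n}) P" "\<And>x. x \<in> carrier P \<Longrightarrow> p (i x) = x"
    unfolding fg_projective_def by blast
  show ?thesis
    unfolding projective_def
  proof (intro conjI *(1) allI impI)
    fix L :: "('a, 'c \<Rightarrow> 'a) module" and N :: "('a, 'c) module" and g f
    assume "module R L \<and> module R N \<and> g \<in> module_hom R L N \<and> g ` carrier L = carrier N \<and> f \<in> module_hom R P N"
    then have a: "module R L" "module R N" "g \<in> module_hom R L N" "g ` carrier L = carrier N"
        "f \<in> module_hom R P N" by auto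
    show "\<exists>h\<in>module_hom R P L. \<forall>x\<in>carrier P. g (h x) = f x"
      by (rule retract_of_free_lift[OF *(1) a(1,2) *(2,3,4) a(3-5)])
  qed
qed

lemma fg_projective_retract:
  assumes P: "fg_projective R P" and "module R Q"
    and i: "i \<in> module_hom R Q P" and p: "p \<in> module_hom R P Q"
    and pi: "\<And>x. x \<in> carrier Q \<Longrightarrow> p (i x) = x"
  shows "fg_projective R Q"
proof -
  from P obtain n j q where j: "j \<in> module_hom R P (free_module R {..<n::nat})"
      and q: "q \<in> module_hom R (free_module R {..<n}) P" and qj: "\<And>x. x \<in> carrier P \<Longrightarrow> q (j x) = x"
    unfolding fg_projective_def by blast
  have "\<forall>x\<in>carrier Q. p (q (j (i x))) = x"
    using pi qj module_hom_closed[OF i] by simp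
  then show ?thesis
    unfolding fg_projective_def
    using assms(2) module_hom_compose[OF i j] module_hom_compose[OF q p] by fast
qed

lemma fg_projective_free:
  assumes "cring R"
  shows "fg_projective R (free_module R {..<n::nat})"
  unfolding fg_projective_def
  using free_module_module[OF assms] module_hom_id by fast

lemma fg_projective_zero:
  assumes "module R P" "carrier P = {\<zero>\<^bsub>P\<^esub>}"
  shows "fg_projective R P"
proof -
  interpret P: module R P by fact
  note free = free_module_module[OF P.R.cring_axioms, of "{..<0::nat}"]
  show ?thesis
    by (rule fg_projective_retract[OF fg_projective_free[OF P.R.cring_axioms, of 0] assms(1)
          module_hom_const_zero[OF free] module_hom_const_zero[OF assms(1)]])
      (use assms(2) in simp)
qed

text \<open>\<open>fin_gen\<close> speaks of a set of generators with one coefficient each, while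
  the images of the unit vectors form a family that may repeat; coefficients over the same value are
  added.\<close>

lemma finsum_combine_repetitions:
  assumes "module R M" "finite A" "f \<in> A \<rightarrow> carrier M" "y \<in> A \<rightarrow> carrier R"
  shows "\<exists>c\<in>f ` A \<rightarrow> carrier R. (\<Oplus>\<^bsub>M\<^esub>s\<in>A. y s \<odot>\<^bsub>M\<^esub> f s) = (\<Oplus>\<^bsub>M\<^esub>t\<in>f ` A. c t \<odot>\<^bsub>M\<^esub> t)"
  using assms(2-4)
proof (induction A)
  case empty
  interpret M: module R M by fact
  show ?case by simp
next
  case (insert a A)
  interpret M: module R M by fact
  from insert obtain c where c: "c \<in> f ` A \<rightarrow> carrier R"
      and eq: "(\<Oplus>\<^bsub>M\<^esub>s\<in>A. y s \<odot>\<^bsub>M\<^esub> f s) = (\<Oplus>\<^bsub>M\<^esub>t\<in>f ` A. c t \<odot>\<^bsub>M\<^esub> t)" by auto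
  have ya: "y a \<in> carrier R" and fa: "f a \<in> carrier M" and fA: "\<And>s. s \<in> A \<Longrightarrow> f s \<in> carrier M"
    and yA: "\<And>s. s \<in> A \<Longrightarrow> y s \<in> carrier R"
    using insert.prems by auto
  have cA: "c (f s) \<in> carrier R" if "s \<in> A" for s using c that by auto
  have ins: "(\<Oplus>\<^bsub>M\<^esub>s\<in>insert a A. y s \<odot>\<^bsub>M\<^esub> f s) =
      y a \<odot>\<^bsub>M\<^esub> f a \<oplus>\<^bsub>M\<^esub> (\<Oplus>\<^bsub>M\<^esub>t\<in>f ` A. c t \<odot>\<^bsub>M\<^esub> t)"
    unfolding eq[symmetric] using insert.hyps ya fa fA yA by (intro M.M.finsum_insert) auto
  \<comment> \<open>The value \<open>f a\<close> is taken out of the old image together with its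
    coefficient \<open>r\<close>, which is zero if \<open>f a\<close> is new; both cases then add
    \<open>y a\<close> in the same way.\<close>
  define B where "B = f ` A - {f a}"
  define r where "r = (if f a \<in> f ` A then c (f a) else \<zero>\<^bsub>R\<^esub>)"
  have r: "r \<in> carrier R" using c by (auto simp: r_def)
  have B: "finite B" "f a \<notin> B" using insert.hyps by (auto simp: B_def)
  have cB: "(\<lambda>t. c t \<odot>\<^bsub>M\<^esub> t) \<in> B \<rightarrow> carrier M" using cA fA by (auto simp: B_def)
  have "(\<Oplus>\<^bsub>M\<^esub>t\<in>f ` A. c t \<odot>\<^bsub>M\<^esub> t) = r \<odot>\<^bsub>M\<^esub> f a \<oplus>\<^bsub>M\<^esub> (\<Oplus>\<^bsub>M\<^esub>t\<in>B. c t \<odot>\<^bsub>M\<^esub> t)"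
  proof (cases "f a \<in> f ` A")
    case True
    then have "f ` A = insert (f a) B" by (auto simp: B_def)
    then show ?thesis using True B cB fa r by (simp add: r_def)
  next
    case False
    then show ?thesis using cB fa by (simp add: r_def B_def)
  qed
  moreover define c' where "c' = c(f a := y a \<oplus>\<^bsub>R\<^esub> r)"
  have "(\<Oplus>\<^bsub>M\<^esub>t\<in>f ` insert a A. c' t \<odot>\<^bsub>M\<^esub> t) =
      (y a \<oplus>\<^bsub>R\<^esub> r) \<odot>\<^bsub>M\<^esub> f a \<oplus>\<^bsub>M\<^esub> (\<Oplus>\<^bsub>M\<^esub>t\<in>B. c t \<odot>\<^bsub>M\<^esub> t)"
  proof -
    have "f ` insert a A = insert (f a) B" by (auto simp: B_def)
    moreover have "(\<Oplus>\<^bsub>M\<^esub>t\<in>insert (f a) B. c' t \<odot>\<^bsub>M\<^esub> t) = c' (f a) \<odot>\<^bsub>M\<^esub> f a \<oplus>\<^bsub>M\<^esub> (\<Oplus>\<^bsub>M\<^esub>t\<in>B. c' t \<odot>\<^bsub>M\<^esub> t)"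
      using B cB fa ya r by (intro M.M.finsum_insert) (auto simp: c'_def Pi_iff)
    moreover have "(\<Oplus>\<^bsub>M\<^esub>t\<in>B. c' t \<odot>\<^bsub>M\<^esub> t) = (\<Oplus>\<^bsub>M\<^esub>t\<in>B. c t \<odot>\<^bsub>M\<^esub> t)"
      using B(2) cB by (intro M.M.finsum_cong') (auto simp: c'_def)
    ultimately show ?thesis by (simp add: c'_def)
  qed
  moreover have "c' \<in> f ` insert a A \<rightarrow> carrier R"
    using c ya r by (auto simp: c'_def)
  moreover have "(\<Oplus>\<^bsub>M\<^esub>t\<in>B. c t \<odot>\<^bsub>M\<^esub> t) \<in> carrier M" using cB by (rule M.M.finsum_closed)
  ultimately show ?case
    using ins ya r fa by (intro bexI[of _ c']) (auto simp: M.smult_l_distr M.M.a_assoc)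
qed

lemma fg_projective_imp_fin_gen:
  assumes "fg_projective R P"
  shows "fin_gen R P"
proof -
  from assms obtain n i p where mP: "module R P" and i: "i \<in> module_hom R P (free_module R {..<n::nat})"
      and p: "p \<in> module_hom R (free_module R {..<n}) P" and pi: "\<And>x. x \<in> carrier P \<Longrightarrow> p (i x) = x"
    unfolding fg_projective_def by blast
  interpret P: module R P by fact
  define c where "c = (\<lambda>s. p (unit_vec R s))"
  have c: "c \<in> {..<n} \<rightarrow> carrier P"
    by (auto simp: c_def intro!: module_hom_closed[OF p] unit_vec_mem[OF P.R.cring_axioms])
  show ?thesis
    unfolding fin_gen_def
  proof (intro exI[of _ "c ` {..<n}"] conjI ballI)
    show "finite (c ` {..<n})" by simp
    show "c ` {..<n} \<subseteq> carrier P" using c by auto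
    fix x assume x: "x \<in> carrier P"
    note ix = module_hom_closed[OF i x]
    have "x = lin_comb R P c (i x)"
      using free_module_hom_eqI[OF P.R.cring_axioms mP p lin_comb_hom[OF mP c] _ ix]
      by (simp add: pi[OF x] lin_comb_unit_vec[OF mP c]) (simp add: c_def)
    also have "\<dots> = (\<Oplus>\<^bsub>P\<^esub>s\<in>{..<n}. i x s \<odot>\<^bsub>P\<^esub> c s)"
      by (rule lin_comb_eq[OF mP c ix]) (use ix in \<open>auto simp: mem_free_module\<close>)
    finally have x_eq: "x = (\<Oplus>\<^bsub>P\<^esub>s\<in>{..<n}. i x s \<odot>\<^bsub>P\<^esub> c s)" .
    have "i x \<in> {..<n} \<rightarrow> carrier R" using ix by (simp add: mem_free_module)
    with finsum_combine_repetitions[OF mP finite_lessThan c]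
    obtain k where "k \<in> c ` {..<n} \<rightarrow> carrier R"
      "(\<Oplus>\<^bsub>P\<^esub>s\<in>{..<n}. i x s \<odot>\<^bsub>P\<^esub> c s) = (\<Oplus>\<^bsub>P\<^esub>t\<in>c ` {..<n}. k t \<odot>\<^bsub>P\<^esub> t)" by blast
    then show "\<exists>k\<in>c ` {..<n} \<rightarrow> carrier R. x = (\<Oplus>\<^bsub>P\<^esub>s\<in>c ` {..<n}. k s \<odot>\<^bsub>P\<^esub> s)"
      using x_eq by auto
  qed
qed

text \<open>Numbering a finite generating set gives a surjection from a free module of finite rank,
  and lifting the identity of \<open>P\<close> along it gives the section.\<close>

lemma fg_projectiveI:
  assumes "projective R P" "fin_gen R P"
  shows "fg_projective R P"
proof -
  have mP: "module R P" using assms(1) by (simp add: projective_def)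
  interpret P: module R P by fact
  from assms(2) obtain S where S: "finite S" "S \<subseteq> carrier P"
      "\<And>x. x \<in> carrier P \<Longrightarrow> \<exists>c \<in> S \<rightarrow> carrier R. x = (\<Oplus>\<^bsub>P\<^esub>s\<in>S. c s \<odot>\<^bsub>P\<^esub> s)"
    unfolding fin_gen_def by blast
  define n where "n = card S"
  obtain b where b: "bij_betw b {..<n} S"
    using ex_bij_betw_nat_finite[OF S(1)] by (auto simp: n_def atLeast0LessThan)
  let ?F = "free_module R {..<n}"
  have bP: "b \<in> {..<n} \<rightarrow> carrier P" using b S(2) by (auto simp: bij_betw_def)
  note g = lin_comb_hom[OF mP bP]
  note free = free_module_module[OF P.R.cring_axioms, of "{..<n}"]
  have "\<exists>y\<in>carrier ?F. lin_comb R P b y = x" if x: "x \<in> carrier P" for x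
  proof -
    from S(3)[OF x] obtain c where c: "c \<in> S \<rightarrow> carrier R" and x_eq: "x = (\<Oplus>\<^bsub>P\<^esub>s\<in>S. c s \<odot>\<^bsub>P\<^esub> s)"
      by blast
    define y where "y = (\<lambda>i. if i < n then c (b i) else \<zero>\<^bsub>R\<^esub>)"
    have bS: "b i \<in> S" if "i < n" for i using b that by (auto simp: bij_betw_def)
    have y: "y \<in> carrier ?F"
      using c bS by (auto simp: mem_free_module_finite y_def)
    have "lin_comb R P b y = (\<Oplus>\<^bsub>P\<^esub>i\<in>{..<n}. y i \<odot>\<^bsub>P\<^esub> b i)"
      by (rule lin_comb_eq[OF mP bP y]) (use y in \<open>auto simp: mem_free_module\<close>)
    also have "\<dots> = (\<Oplus>\<^bsub>P\<^esub>i\<in>{..<n}. c (b i) \<odot>\<^bsub>P\<^esub> b i)"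
      using c bS S(2) by (intro P.M.finsum_cong') (auto simp: y_def Pi_iff)
    also have "\<dots> = (\<Oplus>\<^bsub>P\<^esub>s\<in>b ` {..<n}. c s \<odot>\<^bsub>P\<^esub> s)"
      using b c S(2) by (intro P.M.finsum_reindex[symmetric]) (auto simp: bij_betw_def Pi_iff)
    also have "\<dots> = x" using b x_eq by (simp add: bij_betw_def)
    finally show ?thesis using y by blast
  qed
  then have "lin_comb R P b ` carrier ?F = carrier P"
    using module_hom_closed[OF g] by (metis (no_types, lifting) image_eqI image_subsetI subsetI subset_antisym)
  from projective_lift[OF assms(1) free mP g this module_hom_id]
  show ?thesis unfolding fg_projective_def using mP g by blast
qed

subsection \<open>Products and transport of structure\<close>

definition prod_module :: "('a, 'b) module \<Rightarrow> ('a, 'c) module \<Rightarrow> ('a, 'b \<times> 'c) module" where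
  "prod_module M N = \<lparr>carrier = carrier M \<times> carrier N, monoid.mult = undefined, one = undefined,
     ring.zero = (\<zero>\<^bsub>M\<^esub>, \<zero>\<^bsub>N\<^esub>),
     add = (\<lambda>x y. (fst x \<oplus>\<^bsub>M\<^esub> fst y, snd x \<oplus>\<^bsub>N\<^esub> snd y)),
     module.smult = (\<lambda>r x. (r \<odot>\<^bsub>M\<^esub> fst x, r \<odot>\<^bsub>N\<^esub> snd x))\<rparr>"

lemma prod_module_simps [simp]:
  "carrier (prod_module M N) = carrier M \<times> carrier N"
  "\<zero>\<^bsub>prod_module M N\<^esub> = (\<zero>\<^bsub>M\<^esub>, \<zero>\<^bsub>N\<^esub>)"
  "x \<oplus>\<^bsub>prod_module M N\<^esub> y = (fst x \<oplus>\<^bsub>M\<^esub> fst y, snd x \<oplus>\<^bsub>N\<^esub> snd y)"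
  "r \<odot>\<^bsub>prod_module M N\<^esub> x = (r \<odot>\<^bsub>M\<^esub> fst x, r \<odot>\<^bsub>N\<^esub> snd x)"
  by (simp_all add: prod_module_def)

lemma prod_module_module:
  assumes "module R M" "module R N"
  shows "module R (prod_module M N)"
proof -
  interpret M: module R M by fact
  interpret N: module R N by fact
  have "\<exists>y\<in>carrier M \<times> carrier N. fst y \<oplus>\<^bsub>M\<^esub> a = \<zero>\<^bsub>M\<^esub> \<and> snd y \<oplus>\<^bsub>N\<^esub> b = \<zero>\<^bsub>N\<^esub>"
    if "a \<in> carrier M" "b \<in> carrier N" for a b
    using that by (intro bexI[of _ "(\<ominus>\<^bsub>M\<^esub> a, \<ominus>\<^bsub>N\<^esub> b)"]) (auto simp: M.M.l_neg N.M.l_neg)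
  then show ?thesis
    by (intro moduleI abelian_groupI M.R.cring_axioms)
      (auto simp: M.M.a_ac N.M.a_ac M.smult_l_distr M.smult_r_distr M.smult_assoc1
        N.smult_l_distr N.smult_r_distr N.smult_assoc1)
qed

lemma module_hom_fst: "fst \<in> module_hom R (prod_module M N) M"
  and module_hom_snd: "snd \<in> module_hom R (prod_module M N) N"
  by (auto intro!: module_homI)

lemma module_hom_Pair:
  assumes "f \<in> module_hom R L M" "g \<in> module_hom R L N"
  shows "(\<lambda>x. (f x, g x)) \<in> module_hom R L (prod_module M N)"
  by (rule module_homI)
    (simp_all add: module_hom_closed[OF assms(1)] module_hom_closed[OF assms(2)]
      module_hom_add[OF assms(1)] module_hom_add[OF assms(2)]
      module_hom_smult[OF assms(1)] module_hom_smult[OF assms(2)])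

lemma fg_projective_prod:
  assumes "fg_projective R P" "fg_projective R Q"
  shows "fg_projective R (prod_module P Q)"
proof -
  from assms obtain n i p where mP: "module R P" and i: "i \<in> module_hom R P (free_module R {..<n::nat})"
      and p: "p \<in> module_hom R (free_module R {..<n}) P" and pi: "\<And>x. x \<in> carrier P \<Longrightarrow> p (i x) = x"
    unfolding fg_projective_def by blast
  from assms obtain m j q where mQ: "module R Q" and j: "j \<in> module_hom R Q (free_module R {..<m::nat})"
      and q: "q \<in> module_hom R (free_module R {..<m}) Q" and qj: "\<And>x. x \<in> carrier Q \<Longrightarrow> q (j x) = x"
    unfolding fg_projective_def by blast
  interpret P: module R P by fact
  let ?F = "free_module R {..<n + m}" and ?F1 = "free_module R {..<n}" and ?F2 = "free_module R {..<m}"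
  \<comment> \<open>Concatenation of coordinate blocks; \<open>l\<close> and \<open>r\<close>
    recover the two blocks.\<close>
  define glue where "glue = (\<lambda>(x, y) k. if k < n then x k else y (k - n) :: 'a)"
  define l where "l = (\<lambda>x k. if k < n then x k else \<zero>\<^bsub>R\<^esub>)"
  define r where "r = (\<lambda>(x :: nat \<Rightarrow> 'a) k. x (k + n))"
  have glue: "glue \<in> module_hom R (prod_module ?F1 ?F2) ?F"
    by (rule module_homI) (auto simp: glue_def mem_free_module_finite fun_eq_iff)
  have l: "l \<in> module_hom R ?F ?F1" and r: "r \<in> module_hom R ?F ?F2"
    by (rule module_homI; auto simp: l_def r_def mem_free_module_finite fun_eq_iff)+
  have lr: "l (glue (x, y)) = x" "r (glue (x, y)) = y" if "x \<in> carrier ?F1" "y \<in> carrier ?F2" for x y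
    using that by (auto simp: l_def r_def glue_def mem_free_module_finite fun_eq_iff)
  have "(p (l (glue (i (fst x), j (snd x)))), q (r (glue (i (fst x), j (snd x))))) = x"
    if "x \<in> carrier (prod_module P Q)" for x
    using that lr[OF module_hom_closed[OF i] module_hom_closed[OF j]] by (auto simp: pi qj)
  then show ?thesis
    using fg_projective_retract[OF fg_projective_free[OF P.R.cring_axioms, of "n + m"]
        prod_module_module[OF mP mQ]
        module_hom_compose[OF module_hom_Pair[OF module_hom_compose[OF module_hom_fst i]
            module_hom_compose[OF module_hom_snd j]] glue]
        module_hom_Pair[OF module_hom_compose[OF l p] module_hom_compose[OF r q]]]
    by simp
qed

text \<open>Transport of structure along a map that is injective on the carrier. It brings modules
  into the carrier types prescribed by \<open>FPR\<close> and \<open>fPD\<close>.\<close>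

definition map_module :: "('b \<Rightarrow> 'c) \<Rightarrow> ('a, 'b) module \<Rightarrow> ('a, 'c) module" where
  "map_module j M = \<lparr>carrier = j ` carrier M, monoid.mult = undefined, one = undefined,
     ring.zero = j \<zero>\<^bsub>M\<^esub>,
     add = (\<lambda>x y. j (inv_into (carrier M) j x \<oplus>\<^bsub>M\<^esub> inv_into (carrier M) j y)),
     module.smult = (\<lambda>r x. j (r \<odot>\<^bsub>M\<^esub> inv_into (carrier M) j x))\<rparr>"

lemma map_module_simps [simp]:
  "carrier (map_module j M) = j ` carrier M"
  "\<zero>\<^bsub>map_module j M\<^esub> = j \<zero>\<^bsub>M\<^esub>"
  by (simp_all add: map_module_def)

lemma map_module_ops:
  assumes "inj_on j (carrier M)" "x \<in> carrier M"
  shows "y \<in> carrier M \<Longrightarrow> j x \<oplus>\<^bsub>map_module j M\<^esub> j y = j (x \<oplus>\<^bsub>M\<^esub> y)"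
    and "r \<odot>\<^bsub>map_module j M\<^esub> j x = j (r \<odot>\<^bsub>M\<^esub> x)"
  using assms by (simp_all add: map_module_def inv_into_f_f)

lemma map_module_module:
  assumes "module R M" "inj_on j (carrier M)"
  shows "module R (map_module j M)"
proof -
  interpret M: module R M by fact
  note ops = map_module_ops[OF assms(2)]
  have "\<exists>y\<in>carrier M. j (y \<oplus>\<^bsub>M\<^esub> x) = j \<zero>\<^bsub>M\<^esub>" if "x \<in> carrier M" for x
    using that by (intro bexI[of _ "\<ominus>\<^bsub>M\<^esub> x"]) (auto simp: M.M.l_neg)
  then show ?thesis
    by (intro moduleI abelian_groupI M.R.cring_axioms)
      (auto simp: ops M.M.a_ac M.smult_l_distr M.smult_r_distr M.smult_assoc1)
qed

lemma module_hom_map_module: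
  assumes "inj_on j (carrier M)"
  shows "j \<in> module_hom R M (map_module j M)"
  by (rule module_homI) (auto simp: map_module_ops[OF assms])

lemma module_hom_map_module_inv:
  assumes "module R M" "inj_on j (carrier M)"
  shows "inv_into (carrier M) j \<in> module_hom R (map_module j M) M"
proof -
  interpret M: module R M by fact
  show ?thesis
    by (rule module_homI) (auto simp: map_module_ops[OF assms(2)] inv_into_f_f[OF assms(2)])
qed

lemma fg_projective_map_module:
  assumes "fg_projective R P" "inj_on j (carrier P)"
  shows "fg_projective R (map_module j P)"
proof -
  have mP: "module R P" using assms(1) by (simp add: fg_projective_def)
  show ?thesis
    by (rule fg_projective_retract[OF assms(1) map_module_module[OF mP assms(2)]
          module_hom_map_module_inv[OF mP assms(2)] module_hom_map_module[OF assms(2)]])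
      (auto simp: inv_into_f_f[OF assms(2)])
qed

subsection \<open>Resolutions\<close>

text \<open>The augmentation \<open>e\<close> is treated as the differential leaving degree 0, so
  that exactness becomes a single condition for all degrees.\<close>

definition cycles ::
  "(nat \<Rightarrow> ('a, 'p) module) \<Rightarrow> (nat \<Rightarrow> 'p \<Rightarrow> 'p) \<Rightarrow> ('p \<Rightarrow> 'b) \<Rightarrow> ('a, 'b) module \<Rightarrow> nat \<Rightarrow> 'p set" where
  "cycles P d e M j = (case j of
     0 \<Rightarrow> {x \<in> carrier (P 0). e x = \<zero>\<^bsub>M\<^esub>}
   | Suc i \<Rightarrow> {x \<in> carrier (P (Suc i)). d i x = \<zero>\<^bsub>P i\<^esub>})"

lemma cycles_simps [simp]:
  "cycles P d e M 0 = {x \<in> carrier (P 0). e x = \<zero>\<^bsub>M\<^esub>}"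
  "cycles P d e M (Suc i) = {x \<in> carrier (P (Suc i)). d i x = \<zero>\<^bsub>P i\<^esub>}"
  by (simp_all add: cycles_def)

lemma cycles_subset: "cycles P d e M j \<subseteq> carrier (P j)"
  by (cases j) auto

lemma finite_resolution_iff:
  "finite_resolution R n P d e M \<longleftrightarrow>
     (\<forall>i. module R (P i)) \<and> module R M \<and> (\<forall>i>n. carrier (P i) = {\<zero>\<^bsub>P i\<^esub>}) \<and>
     (\<forall>i. d i \<in> module_hom R (P (Suc i)) (P i)) \<and> e \<in> module_hom R (P 0) M \<and>
     e ` carrier (P 0) = carrier M \<and>
     (\<forall>j. d j ` carrier (P (Suc j)) = cycles P d e M j)"
proof -
  have all: "(\<forall>j. T j) \<longleftrightarrow> T 0 \<and> (\<forall>i. T (Suc i))" for T :: "nat \<Rightarrow> bool"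
    by (metis not0_implies_Suc)
  have "(\<forall>j. d j ` carrier (P (Suc j)) = cycles P d e M j) \<longleftrightarrow>
     d 0 ` carrier (P 1) = a_kernel (P 0) M e \<and>
     (\<forall>i. d (Suc i) ` carrier (P (Suc (Suc i))) = a_kernel (P (Suc i)) (P i) (d i))"
    by (subst all) (simp add: a_kernel_def')
  then show ?thesis unfolding finite_resolution_def by simp
qed

locale resolution =
  fixes R :: "('a, 'r) ring_scheme" and n :: nat and P :: "nat \<Rightarrow> ('a, 'p) module"
    and d :: "nat \<Rightarrow> 'p \<Rightarrow> 'p" and e :: "'p \<Rightarrow> 'b" and M :: "('a, 'b) module"
  assumes resolution: "finite_resolution R n P d e M"
begin

lemma P_module: "module R (P i)"
  and M_module: "module R M"
  and P_zero: "n < i \<Longrightarrow> carrier (P i) = {\<zero>\<^bsub>P i\<^esub>}"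
  and d_hom: "d i \<in> module_hom R (P (Suc i)) (P i)"
  and e_hom: "e \<in> module_hom R (P 0) M"
  and e_surj: "e ` carrier (P 0) = carrier M"
  and d_image: "d j ` carrier (P (Suc j)) = cycles P d e M j"
  using resolution unfolding finite_resolution_iff by blast+

lemma d_cycles: "x \<in> carrier (P (Suc j)) \<Longrightarrow> d j x \<in> cycles P d e M j"
  using d_image by blast

lemma cycles_module: "module R ((P j)\<lparr>carrier := cycles P d e M j\<rparr>)"
  using module_kernel[OF P_module M_module e_hom] module_kernel[OF P_module P_module d_hom]
  by (cases j) auto

lemma cycles_closed: "x \<in> cycles P d e M j \<Longrightarrow> x \<in> carrier (P j)"
  by (rule subsetD[OF cycles_subset])

lemma zero_in_cycles: "\<zero>\<^bsub>P j\<^esub> \<in> cycles P d e M j"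
  using module_hom_zero[OF P_module M_module e_hom] module_hom_zero[OF P_module P_module d_hom]
    abelian_group.axioms(1)[OF module.axioms(2)[OF P_module]]
  by (cases j) (auto simp: abelian_monoid.zero_closed)

lemma cycles_above: "n \<le> j \<Longrightarrow> cycles P d e M j = {\<zero>\<^bsub>P j\<^esub>}"
  using d_image[of j] P_zero[of "Suc j"] module_hom_zero[OF P_module P_module d_hom] by simp

text \<open>By exactness \<open>d j\<close> is onto the submodule of cycles in degree
  \<open>j\<close>, which serves as target of the lifting problem.\<close>

lemma lift_to_cycles:
  assumes "projective R L" "f \<in> module_hom R L (P j)"
    and "\<And>x. x \<in> carrier L \<Longrightarrow> f x \<in> cycles P d e M j"
  obtains h where "h \<in> module_hom R L (P (Suc j))" "\<And>x. x \<in> carrier L \<Longrightarrow> d j (h x) = f x"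
proof -
  have "\<exists>h\<in>module_hom R L (P (Suc j)). \<forall>x\<in>carrier L. d j (h x) = f x"
  proof (rule projective_lift[OF assms(1) P_module cycles_module])
    show "d j \<in> module_hom R (P (Suc j)) ((P j)\<lparr>carrier := cycles P d e M j\<rparr>)"
      by (rule module_hom_carrier_update_cod[OF d_hom]) (simp add: d_image)
    show "f \<in> module_hom R L ((P j)\<lparr>carrier := cycles P d e M j\<rparr>)"
      by (rule module_hom_carrier_update_cod[OF assms(2)]) (use assms(3) in auto)
  qed (simp add: d_image)
  then show thesis using that by blast
qed

lemma lift_to_start:
  assumes "projective R L" "f \<in> module_hom R L M"
  obtains h where "h \<in> module_hom R L (P 0)" "\<And>x. x \<in> carrier L \<Longrightarrow> e (h x) = f x"
  using projective_lift[OF assms(1) P_module M_module e_hom e_surj assms(2)] that by blast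

end

section \<open>Comparison and truncation of resolutions\<close>

text \<open>
  Comparison maps \<open>i\<close>, \<open>p\<close> between the resolutions satisfy \<open>1 - p \<circ> i = s + b \<circ> d\<close>, where
  \<open>s\<close> takes values in the cycles and its lift along \<open>d\<close> is the next homotopy \<open>b\<close>. At and
  beyond the end of \<open>Q\<close> both \<open>p \<circ> i\<close> and \<open>b \<circ> d\<close> vanish on cycles, so \<open>s\<close> is a retraction.
\<close>

lemma cycles_retract:
  assumes P: "finite_resolution R n P d e M" "\<And>i. projective R (P i)"
    and Q: "finite_resolution R m Q d' e' M" "\<And>i. projective R (Q i)"
    and "m \<le> j"
  obtains s where "s \<in> module_hom R (P j) (P j)"
    "\<And>x. x \<in> carrier (P j) \<Longrightarrow> s x \<in> cycles P d e M j"
    "\<And>x. x \<in> cycles P d e M j \<Longrightarrow> s x = x"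
proof -
  interpret P: resolution R n P d e M by unfold_locales (rule P)
  interpret Q: resolution R m Q d' e' M by unfold_locales (rule Q)
  let ?Z = "cycles P d e M" and ?Z' = "cycles Q d' e' M"
  \<comment> \<open>The formula for \<open>s\<close> is kept on cycles only, where the homotopy term
    vanishes. This suffices to continue: in the next degree \<open>i\<close>, \<open>p\<close> and
    \<open>s\<close> are evaluated at boundaries, which are cycles.\<close>
  have "\<exists>i\<in>module_hom R (P j) (Q j). \<exists>p\<in>module_hom R (Q j) (P j). \<exists>s\<in>module_hom R (P j) (P j).
      (\<forall>x\<in>?Z j. i x \<in> ?Z' j) \<and> (\<forall>x\<in>?Z' j. p x \<in> ?Z j) \<and> (\<forall>x\<in>carrier (P j). s x \<in> ?Z j) \<and>
      (\<forall>x\<in>?Z j. s x = x \<ominus>\<^bsub>P j\<^esub> p (i x))"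
  proof (induction j)
    case 0
    obtain i where i: "i \<in> module_hom R (P 0) (Q 0)" "\<And>x. x \<in> carrier (P 0) \<Longrightarrow> e' (i x) = e x"
      using Q.lift_to_start[OF P(2) P.e_hom] by blast
    obtain p where p: "p \<in> module_hom R (Q 0) (P 0)" "\<And>x. x \<in> carrier (Q 0) \<Longrightarrow> e (p x) = e' x"
      using P.lift_to_start[OF Q(2) Q.e_hom] by blast
    note ip = module_hom_compose[OF i(1) p(1)]
    note s = module_hom_minus_fun[OF P.P_module module_hom_id ip]
    have "e (x \<ominus>\<^bsub>P 0\<^esub> p (i x)) = \<zero>\<^bsub>M\<^esub>" if x: "x \<in> carrier (P 0)" for x
      using module_hom_closed[OF i(1) x] module_hom_closed[OF ip x] x module_hom_closed[OF P.e_hom x]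
      by (simp add: module_hom_minus[OF P.P_module P.M_module P.e_hom] i p
          a_minus_eq_zero_iff[OF P.M_module])
    then show ?case
      using i p module_hom_closed[OF i(1)] module_hom_closed[OF p(1)] module_hom_closed[OF s]
      by (intro bexI[OF _ i(1)] bexI[OF _ p(1)] bexI[OF _ s]) auto
  next
    case (Suc j)
    then obtain i p s where i: "i \<in> module_hom R (P j) (Q j)" "\<And>x. x \<in> ?Z j \<Longrightarrow> i x \<in> ?Z' j"
      and p: "p \<in> module_hom R (Q j) (P j)" "\<And>x. x \<in> ?Z' j \<Longrightarrow> p x \<in> ?Z j"
      and s: "s \<in> module_hom R (P j) (P j)" "\<And>x. x \<in> carrier (P j) \<Longrightarrow> s x \<in> ?Z j"
        "\<And>x. x \<in> ?Z j \<Longrightarrow> s x = x \<ominus>\<^bsub>P j\<^esub> p (i x)"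
      by blast
    obtain i' where i': "i' \<in> module_hom R (P (Suc j)) (Q (Suc j))"
        "\<And>x. x \<in> carrier (P (Suc j)) \<Longrightarrow> d' j (i' x) = i (d j x)"
      using Q.lift_to_cycles[OF P(2) module_hom_compose[OF P.d_hom i(1)]] i(2) P.d_cycles by blast
    obtain p' where p': "p' \<in> module_hom R (Q (Suc j)) (P (Suc j))"
        "\<And>x. x \<in> carrier (Q (Suc j)) \<Longrightarrow> d j (p' x) = p (d' j x)"
      using P.lift_to_cycles[OF Q(2) module_hom_compose[OF Q.d_hom p(1)]] p(2) Q.d_cycles by blast
    obtain b where b: "b \<in> module_hom R (P j) (P (Suc j))"
        "\<And>x. x \<in> carrier (P j) \<Longrightarrow> d j (b x) = s x"
      using P.lift_to_cycles[OF P(2) s(1,2)] by blast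
    note ip = module_hom_compose[OF i'(1) p'(1)] and db = module_hom_compose[OF P.d_hom[of j] b(1)]
    note id_ip = module_hom_minus_fun[OF P.P_module module_hom_id ip]
    note s' = module_hom_minus_fun[OF P.P_module id_ip db]
    have "d j (x \<ominus>\<^bsub>P (Suc j)\<^esub> p' (i' x) \<ominus>\<^bsub>P (Suc j)\<^esub> b (d j x)) = \<zero>\<^bsub>P j\<^esub>"
      if x: "x \<in> carrier (P (Suc j))" for x
    proof -
      note [simp] = module_hom_minus[OF P.P_module P.P_module P.d_hom]
      have "d j (x \<ominus>\<^bsub>P (Suc j)\<^esub> p' (i' x)) = s (d j x)"
        using x module_hom_closed[OF ip x] module_hom_closed[OF i'(1) x]
        by (simp add: i' p' s(3) P.d_cycles)
      then show ?thesis
        using x module_hom_closed[OF id_ip x] module_hom_closed[OF db x]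
          module_hom_closed[OF P.d_hom x] module_hom_closed[OF s(1)]
        by (simp add: b a_minus_eq_zero_iff[OF P.P_module])
    qed
    moreover have "x \<ominus>\<^bsub>P (Suc j)\<^esub> p' (i' x) \<ominus>\<^bsub>P (Suc j)\<^esub> b (d j x) = x \<ominus>\<^bsub>P (Suc j)\<^esub> p' (i' x)"
      if x: "x \<in> ?Z (Suc j)" for x
    proof -
      interpret PS: module R "P (Suc j)" by (rule P.P_module)
      have "b (d j x) = \<zero>\<^bsub>P (Suc j)\<^esub>"
        using x module_hom_zero[OF P.P_module P.P_module b(1)] by simp
      then show ?thesis
        using x module_hom_closed[OF id_ip, of x] by (simp add: a_minus_def)
    qed
    ultimately show ?case
      using i' p' module_hom_closed[OF i'(1)] module_hom_closed[OF p'(1)] module_hom_closed[OF s']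
        module_hom_zero[OF P.P_module Q.P_module i(1)] module_hom_zero[OF Q.P_module P.P_module p(1)]
      by (intro bexI[OF _ i'(1)] bexI[OF _ p'(1)] bexI[OF _ s']) auto
  qed
  then obtain i p s where i: "i \<in> module_hom R (P j) (Q j)" "\<And>x. x \<in> ?Z j \<Longrightarrow> i x \<in> ?Z' j"
      and p: "p \<in> module_hom R (Q j) (P j)"
      and s: "s \<in> module_hom R (P j) (P j)" "\<And>x. x \<in> carrier (P j) \<Longrightarrow> s x \<in> ?Z j"
        "\<And>x. x \<in> ?Z j \<Longrightarrow> s x = x \<ominus>\<^bsub>P j\<^esub> p (i x)"
    by blast
  interpret Pj: module R "P j" by (rule P.P_module)
  \<comment> \<open>From degree \<open>m\<close> on the cycles of \<open>Q\<close> are zero, so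
    \<open>i x\<close> vanishes and the correction disappears.\<close>
  have "s x = x" if "x \<in> ?Z j" for x
    using s(3)[OF that] i(2)[OF that] Q.cycles_above[OF \<open>m \<le> j\<close>] P.cycles_closed[OF that]
      module_hom_zero[OF Q.P_module P.P_module p]
    by (simp add: a_minus_def)
  with s show thesis using that by blast
qed

text \<open>\<open>s\<close> is a projection of \<open>P m\<close> onto its cycles, so the kernel of
  \<open>s\<close> is a complement, isomorphic to \<open>P m\<close> modulo cycles. It becomes the
  last term: a retract of \<open>P m\<close> via \<open>x - s x\<close>, on which the outgoing map
  is injective with unchanged image. For \<open>m = 0\<close> the outgoing map is
  \<open>e\<close>.\<close>

lemma truncate_resolution:
  fixes P :: "nat \<Rightarrow> ('a, 'p) module"
  assumes res: "finite_resolution R n P d e M" and proj: "\<And>i. fg_projective R (P i)"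
    and s: "s \<in> module_hom R (P m) (P m)"
      "\<And>x. x \<in> carrier (P m) \<Longrightarrow> s x \<in> cycles P d e M m"
      "\<And>x. x \<in> cycles P d e M m \<Longrightarrow> s x = x"
  obtains P' :: "nat \<Rightarrow> ('a, 'p) module" and d'
  where "finite_resolution R m P' d' e M" "\<And>i. fg_projective R (P' i)"
proof -
  interpret P: resolution R n P d e M by unfold_locales (rule res)
  define P' where "P' = (\<lambda>i. if i < m then P i
    else (P i)\<lparr>carrier := if i = m then {x \<in> carrier (P m). s x = \<zero>\<^bsub>P m\<^esub>} else {\<zero>\<^bsub>P i\<^esub>}\<rparr>)"
  define d' where "d' = (\<lambda>i. if i < m then d i else (\<lambda>_. \<zero>\<^bsub>P i\<^esub>))"
  interpret Pi: module R "P i" for i by (rule P.P_module)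
  have zero: "\<zero>\<^bsub>P' i\<^esub> = \<zero>\<^bsub>P i\<^esub>" for i by (simp add: P'_def)
  have P'_lt: "P' i = P i" if "i < m" for i using that by (simp add: P'_def)
  have P'_m: "P' m = (P m)\<lparr>carrier := {x \<in> carrier (P m). s x = \<zero>\<^bsub>P m\<^esub>}\<rparr>"
    by (simp add: P'_def)
  have P'_gt: "carrier (P' i) = {\<zero>\<^bsub>P' i\<^esub>}" if "m < i" for i using that by (simp add: P'_def)
  have s_comp: "s (x \<ominus>\<^bsub>P m\<^esub> s x) = \<zero>\<^bsub>P m\<^esub>" if "x \<in> carrier (P m)" for x
    using that s(2)[OF that] module_hom_closed[OF s(1)] s(3)[OF s(2)[OF that]]
    by (simp add: module_hom_minus[OF P.P_module P.P_module s(1)] a_minus_eq_zero_iff[OF P.P_module])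
  have module': "module R (P' i)" for i
    using module_kernel[OF P.P_module P.P_module s(1)] P.P_module[of i]
      module_carrier_update[OF P.P_module[of i], of "{\<zero>\<^bsub>P i\<^esub>}"]
    by (auto simp: P'_def)
  have subset: "carrier (P' i) \<subseteq> carrier (P i)" for i by (auto simp: P'_def)
  have proj': "fg_projective R (P' i)" for i
  proof (cases "i = m")
    case True
    note r = module_hom_minus_fun[OF P.P_module module_hom_id s(1)]
    have r': "(\<lambda>x. x \<ominus>\<^bsub>P m\<^esub> s x) \<in> module_hom R (P m) (P' m)"
      unfolding P'_m using module_hom_closed[OF r] s_comp
      by (intro module_hom_carrier_update_cod[OF r]) auto
    have "(\<lambda>x. x) \<in> module_hom R (P' m) (P m)"
      unfolding P'_m by (intro module_hom_carrier_update_dom module_hom_id) auto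
    from fg_projective_retract[OF proj module' this r'] show ?thesis
      using True by (simp add: P'_m a_minus_def)
  qed (use module' proj fg_projective_zero P'_lt P'_gt in \<open>metis nat_neq_iff\<close>)
  have image_eq: "f ` A = f ` B" if "A \<subseteq> B" "\<And>x. x \<in> B \<Longrightarrow> \<exists>y\<in>A. f y = f x" for f :: "'p \<Rightarrow> 'x" and A B
    using that by (metis (no_types, lifting) image_eqI image_mono image_subsetI subset_antisym)
  \<comment> \<open>Passing from \<open>x\<close> to \<open>x - s x\<close> does not change the
    image, since \<open>s x\<close> is a cycle. Positivity makes \<open>m - 1\<close> a genuine
    predecessor.\<close>
  have d_sub: "d (m - 1) ` carrier (P' m) = d (m - 1) ` carrier (P m)" if pos: "0 < m"
  proof -
    obtain k where m: "m = Suc k" using pos by (cases m) auto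
    have "\<exists>y\<in>carrier (P' m). d k y = d k x" if x: "x \<in> carrier (P m)" for x
    proof
      show "x \<ominus>\<^bsub>P m\<^esub> s x \<in> carrier (P' m)"
        using s_comp x module_hom_closed[OF s(1) x] by (simp add: P'_m)
      have "d k (s x) = \<zero>\<^bsub>P k\<^esub>" using s(2)[OF x] by (simp add: m)
      then show "d k (x \<ominus>\<^bsub>P m\<^esub> s x) = d k x"
        using x module_hom_closed[OF s(1) x] module_hom_closed[OF P.d_hom, of x k]
        by (simp add: m module_hom_minus[OF P.P_module P.P_module P.d_hom]) (simp add: a_minus_def)
    qed
    then have "d k ` carrier (P' m) = d k ` carrier (P m)" by (rule image_eq[OF subset])
    then show ?thesis by (simp add: m)
  qed
  have "finite_resolution R m P' d' e M"
    unfolding finite_resolution_iff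
  proof (intro conjI allI impI module' P.M_module P'_gt)
    show "d' i \<in> module_hom R (P' (Suc i)) (P' i)" for i
    proof (cases "i < m")
      case True
      then have "P' (Suc i) = (P (Suc i))\<lparr>carrier := carrier (P' (Suc i))\<rparr>" by (simp add: P'_def)
      with True show ?thesis
        using module_hom_carrier_update_dom[OF P.d_hom subset] by (metis P'_lt d'_def)
    next
      case False
      then show ?thesis
        using module_hom_const_zero[OF module', of i "P' (Suc i)"] by (simp add: d'_def zero)
    qed
    have P'_0: "P' 0 = (P 0)\<lparr>carrier := carrier (P' 0)\<rparr>" by (simp add: P'_def)
    show "e \<in> module_hom R (P' 0) M"
      by (subst P'_0) (rule module_hom_carrier_update_dom[OF P.e_hom subset])
    show "e ` carrier (P' 0) = carrier M"
    proof (cases "m = 0")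
      case True
      have "\<exists>y\<in>carrier (P' 0). e y = e x" if x: "x \<in> carrier (P 0)" for x
      proof
        show "x \<ominus>\<^bsub>P 0\<^esub> s x \<in> carrier (P' 0)"
          using s_comp x module_hom_closed[OF s(1)] True P'_m by simp
        interpret M: module R M by (rule P.M_module)
        have "e (s x) = \<zero>\<^bsub>M\<^esub>" using s(2) x True by simp
        then show "e (x \<ominus>\<^bsub>P 0\<^esub> s x) = e x"
          using x module_hom_closed[OF s(1)] module_hom_closed[OF P.e_hom, of x] True
          by (simp add: module_hom_minus[OF P.P_module P.M_module P.e_hom]) (simp add: a_minus_def)
      qed
      then have "e ` carrier (P' 0) = e ` carrier (P 0)" by (rule image_eq[OF subset])
      then show ?thesis using P.e_surj by simp
    next
      case False
      then show ?thesis using P.e_surj by (simp add: P'_lt)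
    qed
    show "d' j ` carrier (P' (Suc j)) = cycles P' d' e M j" for j
    proof -
      have cyc: "cycles P' d' e M j = cycles P d e M j \<inter> carrier (P' j)" if "j \<le> m"
        using that subset[of j] by (cases j) (auto simp: d'_def zero)
      show ?thesis
      proof (cases "j < m")
        case True
        have "d j ` carrier (P' (Suc j)) = d j ` carrier (P (Suc j))"
        proof (cases "Suc j = m")
          case True
          then show ?thesis using d_sub by force
        next
          case False
          then show ?thesis using True by (simp add: P'_lt)
        qed
        moreover have "cycles P' d' e M j = cycles P d e M j"
          using True cyc P'_lt[OF True] cycles_subset[of P d e M j] by (simp add: Int_absorb2)
        ultimately show ?thesis
          using True P.d_image[of j] by (simp add: d'_def)
      next
        case False
        have "cycles P' d' e M j = {\<zero>\<^bsub>P j\<^esub>}"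
        proof (cases "j = m")
          case True
          have "\<zero>\<^bsub>P m\<^esub> \<in> cycles P d e M m \<inter> carrier (P' m)"
            using P.zero_in_cycles module_hom_zero[OF P.P_module P.P_module s(1)] by (simp add: P'_m)
          \<comment> \<open>A cycle in the kernel of \<open>s\<close> equals \<open>s x\<close>,
            hence is zero: the new last map is injective.\<close>
          moreover have "x = \<zero>\<^bsub>P m\<^esub>" if "x \<in> cycles P d e M m \<inter> carrier (P' m)" for x
            using that s(3) by (auto simp: P'_m)
          ultimately have "cycles P d e M m \<inter> carrier (P' m) = {\<zero>\<^bsub>P m\<^esub>}" by blast
          then show ?thesis using cyc True by simp
        next
          case False
          then have "m < j" using \<open>\<not> j < m\<close> by simp
          then show ?thesis
            using P'_gt[of j] by (cases j) (auto simp: d'_def zero)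
        qed
        then show ?thesis
          using False P'_gt[of "Suc j"] by (simp add: d'_def)
      qed
    qed
  qed
  then show thesis using proj' that by blast
qed

text \<open>Moves the terms along \<open>J\<close> and the resolved module along \<open>f\<close>.
  As \<open>J\<close> is injective on the whole type, one inverse serves all degrees;
  \<open>f\<close> need be injective on the carrier of \<open>M\<close> only.\<close>

lemma map_resolution:
  fixes J :: "'p \<Rightarrow> 'q"
  assumes res: "finite_resolution R n P d e M" and J: "inj J" and f: "inj_on f (carrier M)"
  shows "finite_resolution R n (\<lambda>i. map_module J (P i)) (\<lambda>i x. J (d i (the_inv J x)))
     (\<lambda>x. f (e (the_inv J x))) (map_module f M)"
proof -
  interpret P: resolution R n P d e M by unfold_locales (rule res)
  interpret M: module R M by (rule P.M_module)
  have Jon: "inj_on J A" for A using J by (rule inj_on_subset) simp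
  have iJ: "the_inv J \<in> module_hom R (map_module J (P i)) (P i)" for i
    by (rule module_homI) (auto simp: map_module_ops[OF Jon] the_inv_f_f[OF J]
        intro: module.smult_closed[OF P.P_module] abelian_groupE(1)[OF module.axioms(2)[OF P.P_module]])
  show ?thesis
    unfolding finite_resolution_iff
  proof (intro conjI allI impI map_module_module P.P_module P.M_module Jon f)
    show "carrier (map_module J (P i)) = {\<zero>\<^bsub>map_module J (P i)\<^esub>}" if "n < i" for i
      using P.P_zero[OF that] by simp
    show "(\<lambda>x. J (d i (the_inv J x))) \<in> module_hom R (map_module J (P (Suc i))) (map_module J (P i))" for i
      by (rule module_hom_compose[OF module_hom_compose[OF iJ P.d_hom] module_hom_map_module[OF Jon]])
    show "(\<lambda>x. f (e (the_inv J x))) \<in> module_hom R (map_module J (P 0)) (map_module f M)"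
      by (rule module_hom_compose[OF module_hom_compose[OF iJ P.e_hom] module_hom_map_module[OF f]])
    show "(\<lambda>x. f (e (the_inv J x))) ` carrier (map_module J (P 0)) = carrier (map_module f M)"
      using P.e_surj by (force simp: image_image the_inv_f_f[OF J])
    have "f (e x) = f \<zero>\<^bsub>M\<^esub> \<longleftrightarrow> e x = \<zero>\<^bsub>M\<^esub>" if "x \<in> carrier (P 0)" for x
      using f module_hom_closed[OF P.e_hom that] by (simp add: inj_on_eq_iff)
    then have "J ` cycles P d e M j = cycles (\<lambda>i. map_module J (P i)) (\<lambda>i x. J (d i (the_inv J x)))
        (\<lambda>x. f (e (the_inv J x))) (map_module f M) j" for j
      by (cases j) (auto simp: the_inv_f_f[OF J] inj_eq[OF J])
    then show "(\<lambda>x. J (d j (the_inv J x))) ` carrier (map_module J (P (Suc j))) =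
        cycles (\<lambda>i. map_module J (P i)) (\<lambda>i x. J (d i (the_inv J x)))
        (\<lambda>x. f (e (the_inv J x))) (map_module f M) j" for j
      by (simp add: image_image the_inv_f_f[OF J] P.d_image[symmetric])
  qed
qed

subsection \<open>Change of rings\<close>

text \<open>The quotient is given abstractly, by a surjection with kernel \<open>aR\<close>, so that
  no coset arithmetic enters the arguments.\<close>

locale regular_quotient =
  fixes R :: "('a, 'r) ring_scheme" and S :: "('c, 's) ring_scheme" and q :: "'a \<Rightarrow> 'c" and a :: 'a
  assumes R_cring: "cring R" and S_cring: "cring S"
    and q_ring_hom: "q \<in> ring_hom R S" and q_surj: "q ` carrier R = carrier S"
    and a_closed: "a \<in> carrier R"
    and q_kernel: "r \<in> carrier R \<Longrightarrow> q r = \<zero>\<^bsub>S\<^esub> \<longleftrightarrow> (\<exists>s\<in>carrier R. r = a \<otimes>\<^bsub>R\<^esub> s)"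
    and a_regular: "r \<in> carrier R \<Longrightarrow> a \<otimes>\<^bsub>R\<^esub> r = \<zero>\<^bsub>R\<^esub> \<Longrightarrow> r = \<zero>\<^bsub>R\<^esub>"
begin

sublocale R: cring R by (rule R_cring)
sublocale S: cring S by (rule S_cring)

lemma q_closed: "r \<in> carrier R \<Longrightarrow> q r \<in> carrier S"
  using q_surj by blast

lemma q_zero: "q \<zero>\<^bsub>R\<^esub> = \<zero>\<^bsub>S\<^esub>"
  using q_kernel[of "\<zero>\<^bsub>R\<^esub>"] R.r_null[OF a_closed] by (metis R.zero_closed)

definition restrict_scalars :: "('c, 'b) module \<Rightarrow> ('a, 'b) module" where
  "restrict_scalars M = \<lparr>carrier = carrier M, monoid.mult = undefined, one = undefined,
     ring.zero = \<zero>\<^bsub>M\<^esub>, add = add M, module.smult = (\<lambda>r x. q r \<odot>\<^bsub>M\<^esub> x)\<rparr>"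

lemma restrict_scalars_simps [simp]:
  "carrier (restrict_scalars M) = carrier M"
  "\<zero>\<^bsub>restrict_scalars M\<^esub> = \<zero>\<^bsub>M\<^esub>"
  "x \<oplus>\<^bsub>restrict_scalars M\<^esub> y = x \<oplus>\<^bsub>M\<^esub> y"
  "r \<odot>\<^bsub>restrict_scalars M\<^esub> x = q r \<odot>\<^bsub>M\<^esub> x"
  by (simp_all add: restrict_scalars_def)

lemma restrict_scalars_uminus [simp]:
  "\<ominus>\<^bsub>restrict_scalars M\<^esub> x = \<ominus>\<^bsub>M\<^esub> x"
  "x \<ominus>\<^bsub>restrict_scalars M\<^esub> y = x \<ominus>\<^bsub>M\<^esub> y"
  by (simp_all add: restrict_scalars_def a_inv_def m_inv_def a_minus_def)

lemma restrict_scalars_module: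
  assumes "module S M"
  shows "module R (restrict_scalars M)"
proof -
  interpret M: module S M by fact
  have "\<exists>y\<in>carrier M. y \<oplus>\<^bsub>M\<^esub> x = \<zero>\<^bsub>M\<^esub>" if "x \<in> carrier M" for x
    using that by (intro bexI[of _ "\<ominus>\<^bsub>M\<^esub> x"]) (auto simp: M.M.l_neg)
  then show ?thesis
    by (intro moduleI abelian_groupI R_cring)
      (auto simp: M.M.a_ac M.smult_l_distr M.smult_r_distr M.smult_assoc1 q_closed
        ring_hom_add[OF q_ring_hom] ring_hom_mult[OF q_ring_hom] ring_hom_one[OF q_ring_hom])
qed

lemma module_hom_restrict_scalars_iff:
  "f \<in> module_hom R (restrict_scalars M) (restrict_scalars N) \<longleftrightarrow> f \<in> module_hom S M N"
  by (simp add: module_hom_def flip: q_surj)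

section \<open>Coordinatewise reduction modulo \<open>a\<close>, and division by
  \<open>a\<close>\<close>

definition reduce :: "('i \<Rightarrow> 'a) \<Rightarrow> 'i \<Rightarrow> 'c" where
  "reduce x = (\<lambda>i. q (x i))"

lemma reduce_hom: "reduce \<in> module_hom R (free_module R I) (restrict_scalars (free_module S I))"
proof (rule module_homI)
  show "reduce x \<in> carrier (restrict_scalars (free_module S I))" if "x \<in> carrier (free_module R I)" for x
  proof -
    have "{i. q (x i) \<noteq> \<zero>\<^bsub>S\<^esub>} \<subseteq> {i. x i \<noteq> \<zero>\<^bsub>R\<^esub>}" using q_zero by auto
    then show ?thesis
      using that by (auto simp: mem_free_module reduce_def q_closed intro: finite_subset)
  qed
qed (auto simp: mem_free_module reduce_def fun_eq_iff ring_hom_add[OF q_ring_hom] ring_hom_mult[OF q_ring_hom])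

lemma reduce_surj: "reduce ` carrier (free_module R I) = carrier (restrict_scalars (free_module S I))"
proof (intro equalityI image_subsetI subsetI)
  fix y assume y: "y \<in> carrier (restrict_scalars (free_module S I))"
  have "\<forall>c\<in>carrier S. \<exists>r\<in>carrier R. q r = c" using q_surj by (metis imageE)
  then obtain l where l: "\<And>c. c \<in> carrier S \<Longrightarrow> l c \<in> carrier R \<and> q (l c) = c" by metis
  define x where "x = (\<lambda>i. if y i = \<zero>\<^bsub>S\<^esub> then \<zero>\<^bsub>R\<^esub> else l (y i))"
  have "{i. x i \<noteq> \<zero>\<^bsub>R\<^esub>} \<subseteq> {i. y i \<noteq> \<zero>\<^bsub>S\<^esub>}" by (auto simp: x_def)
  then have "x \<in> carrier (free_module R I)"
    using y l by (auto simp: mem_free_module x_def intro: finite_subset)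
  moreover have "reduce x = y"
    using y l by (auto simp: mem_free_module reduce_def x_def q_zero fun_eq_iff)
  ultimately show "y \<in> reduce ` carrier (free_module R I)" by blast
qed (rule module_hom_closed[OF reduce_hom])

lemma reduce_eq_zero:
  assumes "x \<in> carrier (free_module R I)" "reduce x = \<zero>\<^bsub>free_module S I\<^esub>"
  shows "\<exists>y\<in>carrier (free_module R I). x = a \<odot>\<^bsub>free_module R I\<^esub> y"
proof -
  have "\<forall>i. \<exists>s\<in>carrier R. x i = a \<otimes>\<^bsub>R\<^esub> s"
    using assms q_kernel by (fastforce simp: mem_free_module reduce_def fun_eq_iff)
  then obtain l where l: "\<And>i. l i \<in> carrier R \<and> x i = a \<otimes>\<^bsub>R\<^esub> l i" by metis
  \<comment> \<open>Regularity of \<open>a\<close> prevents the quotient from acquiring new nonzero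
    coordinates, so finite support survives.\<close>
  have "{i. l i \<noteq> \<zero>\<^bsub>R\<^esub>} = {i. x i \<noteq> \<zero>\<^bsub>R\<^esub>}"
    using l a_regular a_closed by (metis (no_types, lifting) R.r_null)
  then have "l \<in> carrier (free_module R I)" using assms(1) l by (auto simp: mem_free_module)
  then show ?thesis using l by (auto simp: fun_eq_iff)
qed

lemma reduce_smult_a:
  assumes "x \<in> carrier (free_module R I)"
  shows "reduce (a \<odot>\<^bsub>free_module R I\<^esub> x) = \<zero>\<^bsub>free_module S I\<^esub>"
  using assms a_closed q_kernel by (auto simp: reduce_def mem_free_module fun_eq_iff)

lemma smult_a_cancel:
  assumes "x \<in> carrier (free_module R I)" "y \<in> carrier (free_module R I)"
    and "a \<odot>\<^bsub>free_module R I\<^esub> x = a \<odot>\<^bsub>free_module R I\<^esub> y"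
  shows "x = y"
proof
  fix i
  have xy: "x i \<in> carrier R" "y i \<in> carrier R" using assms by (auto simp: mem_free_module)
  have "a \<otimes>\<^bsub>R\<^esub> x i = a \<otimes>\<^bsub>R\<^esub> y i" using assms(3) by (simp add: fun_eq_iff)
  then have "a \<otimes>\<^bsub>R\<^esub> (x i \<ominus>\<^bsub>R\<^esub> y i) = \<zero>\<^bsub>R\<^esub>"
    using xy a_closed by (simp add: a_minus_def R.r_distr R.r_minus R.r_neg)
  then show "x i = y i" using a_regular[of "x i \<ominus>\<^bsub>R\<^esub> y i"] xy by simp
qed

text \<open>Since \<open>a\<close> can be cancelled in a free module, the pointwise quotient is
  unique; additivity and homogeneity of \<open>g\<close> follow by comparing multiples by
  \<open>a\<close>.\<close>

lemma divide_hom: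
  assumes "module R A" "f \<in> module_hom R A (free_module R I)"
    and "\<And>x. x \<in> carrier A \<Longrightarrow> reduce (f x) = \<zero>\<^bsub>free_module S I\<^esub>"
  obtains g where "g \<in> module_hom R A (free_module R I)"
    "\<And>x. x \<in> carrier A \<Longrightarrow> f x = a \<odot>\<^bsub>free_module R I\<^esub> g x"
proof -
  let ?F = "free_module R I"
  interpret A: module R A by fact
  interpret F: module R ?F by (rule free_module_module[OF R_cring])
  have "\<forall>x\<in>carrier A. \<exists>y\<in>carrier ?F. f x = a \<odot>\<^bsub>?F\<^esub> y"
    using reduce_eq_zero module_hom_closed[OF assms(2)] assms(3) by blast
  then obtain g where g: "\<And>x. x \<in> carrier A \<Longrightarrow> g x \<in> carrier ?F"
      "\<And>x. x \<in> carrier A \<Longrightarrow> f x = a \<odot>\<^bsub>?F\<^esub> g x"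
    by metis
  have "g \<in> module_hom R A ?F"
  proof (rule module_homI)
    show "g (x \<oplus>\<^bsub>A\<^esub> y) = g x \<oplus>\<^bsub>?F\<^esub> g y" if "x \<in> carrier A" "y \<in> carrier A" for x y
    proof (rule smult_a_cancel)
      have "a \<odot>\<^bsub>?F\<^esub> g (x \<oplus>\<^bsub>A\<^esub> y) = a \<odot>\<^bsub>?F\<^esub> g x \<oplus>\<^bsub>?F\<^esub> a \<odot>\<^bsub>?F\<^esub> g y"
        using that module_hom_add[OF assms(2) that] g(2) by (metis A.M.a_closed)
      also have "\<dots> = a \<odot>\<^bsub>?F\<^esub> (g x \<oplus>\<^bsub>?F\<^esub> g y)"
        using F.smult_r_distr[OF a_closed g(1) g(1)] that by metis
      finally show "a \<odot>\<^bsub>?F\<^esub> g (x \<oplus>\<^bsub>A\<^esub> y) = a \<odot>\<^bsub>?F\<^esub> (g x \<oplus>\<^bsub>?F\<^esub> g y)" .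
    qed (intro g(1) F.M.a_closed A.M.a_closed that)+
    show "g (r \<odot>\<^bsub>A\<^esub> x) = r \<odot>\<^bsub>?F\<^esub> g x" if r: "r \<in> carrier R" and x: "x \<in> carrier A" for r x
    proof (rule smult_a_cancel)
      have "a \<odot>\<^bsub>?F\<^esub> g (r \<odot>\<^bsub>A\<^esub> x) = r \<odot>\<^bsub>?F\<^esub> (a \<odot>\<^bsub>?F\<^esub> g x)"
        using module_hom_smult[OF assms(2) r x] g(2) r x by (metis A.smult_closed)
      also have "\<dots> = a \<odot>\<^bsub>?F\<^esub> (r \<odot>\<^bsub>?F\<^esub> g x)"
        using F.smult_assoc1[OF r a_closed g(1)[OF x]] F.smult_assoc1[OF a_closed r g(1)[OF x]]
          R.m_comm[OF r a_closed] by metis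
      finally show "a \<odot>\<^bsub>?F\<^esub> g (r \<odot>\<^bsub>A\<^esub> x) = a \<odot>\<^bsub>?F\<^esub> (r \<odot>\<^bsub>?F\<^esub> g x)" .
    qed (intro g(1) F.smult_closed A.smult_closed r x)+
  qed (rule g(1))
  then show thesis using g(2) that by blast
qed

lemma lift_along_reduce:
  assumes "f \<in> module_hom R (free_module R {..<k::nat}) (restrict_scalars (free_module S I))"
  obtains h where "h \<in> module_hom R (free_module R {..<k}) (free_module R I)"
    "\<And>x. x \<in> carrier (free_module R {..<k}) \<Longrightarrow> reduce (h x) = f x"
  using projective_lift[OF fg_projective_imp_projective[OF fg_projective_free[OF R_cring]]
      free_module_module[OF R_cring] restrict_scalars_module[OF free_module_module[OF S_cring]]
      reduce_hom reduce_surj assms] that by blast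

end

text \<open>The retractions are fixed as data because the lifts to \<open>R\<close> are built from
  them. \<open>N_zero\<close> has to be imposed: the zero module is a retract of free modules of any
  rank, and a positive rank above \<open>m\<close> would lengthen the resolution over
  \<open>R\<close>.\<close>

locale projective_resolution_over_quotient =
  regular_quotient R S q a + P: resolution S m P d e M
  for R :: "('a, 'r) ring_scheme" and S :: "('c, 's) ring_scheme" and q a
    and m P and d :: "nat \<Rightarrow> 'p \<Rightarrow> 'p" and e :: "'p \<Rightarrow> 'b" and M +
  fixes N :: "nat \<Rightarrow> nat" and \<iota> :: "nat \<Rightarrow> 'p \<Rightarrow> nat \<Rightarrow> 'c" and \<pi> :: "nat \<Rightarrow> (nat \<Rightarrow> 'c) \<Rightarrow> 'p"
  assumes iota_hom: "\<iota> i \<in> module_hom S (P i) (free_module S {..<N i})"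
    and pi_hom: "\<pi> i \<in> module_hom S (free_module S {..<N i}) (P i)"
    and pi_iota: "x \<in> carrier (P i) \<Longrightarrow> \<pi> i (\<iota> i x) = x"
    and N_zero: "m < i \<Longrightarrow> N i = 0"
begin

section \<open>Free covers of the terms and lifted differentials\<close>

abbreviation F :: "nat \<Rightarrow> ('a, nat \<Rightarrow> 'a) module" where
  "F i \<equiv> free_module R {..<N i}"

abbreviation Pr :: "nat \<Rightarrow> ('a, 'p) module" where
  "Pr i \<equiv> restrict_scalars (P i)"

abbreviation Z :: "nat \<Rightarrow> 'p set" where
  "Z \<equiv> cycles P d e M"

definition cl :: "nat \<Rightarrow> (nat \<Rightarrow> 'a) \<Rightarrow> 'p" where
  "cl i x = \<pi> i (reduce x)"

lemma F_module: "module R (F i)"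
  by (rule free_module_module[OF R_cring])

lemma Pr_module: "module R (Pr i)"
  by (rule restrict_scalars_module[OF P.P_module])

lemma cl_hom: "cl i \<in> module_hom R (F i) (Pr i)"
  using module_hom_compose[OF reduce_hom pi_hom[folded module_hom_restrict_scalars_iff]]
  by (simp add: cl_def[abs_def])

lemma cl_closed: "x \<in> carrier (F i) \<Longrightarrow> cl i x \<in> carrier (P i)"
  using module_hom_closed[OF cl_hom] by fastforce

lemma cl_surj: "cl i ` carrier (F i) = carrier (Pr i)"
proof (intro equalityI subsetI image_subsetI)
  fix y assume y: "y \<in> carrier (Pr i)"
  then have "\<iota> i y \<in> reduce ` carrier (F i)"
    unfolding reduce_surj using module_hom_closed[OF iota_hom] by simp
  then show "y \<in> cl i ` carrier (F i)" using pi_iota y by (force simp: cl_def)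
qed (use module_hom_closed[OF cl_hom] in blast)

lemma cl_zero: "cl i \<zero>\<^bsub>F i\<^esub> = \<zero>\<^bsub>P i\<^esub>"
  using module_hom_zero[OF F_module Pr_module cl_hom] by simp

lemma cl_smult_a:
  assumes "x \<in> carrier (F i)"
  shows "cl i (a \<odot>\<^bsub>F i\<^esub> x) = \<zero>\<^bsub>P i\<^esub>"
  using reduce_smult_a[OF assms]
    module_hom_zero[OF free_module_module[OF S_cring] P.P_module pi_hom] by (simp add: cl_def)

text \<open>One lift of the differential is fixed per degree. Composites of consecutive
  \<open>phi\<close> need not vanish; by \<open>cl_phi\<close> their classes do, so they take values
  in \<open>K\<close>.\<close>

definition phi :: "nat \<Rightarrow> (nat \<Rightarrow> 'a) \<Rightarrow> nat \<Rightarrow> 'a" where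
  "phi i = (SOME h. h \<in> module_hom R (F (Suc i)) (F i) \<and>
     (\<forall>x\<in>carrier (F (Suc i)). reduce (h x) = \<iota> i (d i (cl (Suc i) x))))"

lemma phi_hom: "phi i \<in> module_hom R (F (Suc i)) (F i)"
  and reduce_phi: "x \<in> carrier (F (Suc i)) \<Longrightarrow> reduce (phi i x) = \<iota> i (d i (cl (Suc i) x))"
proof -
  have "(\<lambda>x. \<iota> i (d i (cl (Suc i) x))) \<in>
      module_hom R (F (Suc i)) (restrict_scalars (free_module S {..<N i}))"
    using module_hom_compose[OF module_hom_compose[OF cl_hom
        P.d_hom[folded module_hom_restrict_scalars_iff]] iota_hom[folded module_hom_restrict_scalars_iff]] .
  from lift_along_reduce[OF this]
  have "\<exists>h. h \<in> module_hom R (F (Suc i)) (F i) \<and>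
     (\<forall>x\<in>carrier (F (Suc i)). reduce (h x) = \<iota> i (d i (cl (Suc i) x)))" by metis
  from someI_ex[OF this, folded phi_def]
  show "phi i \<in> module_hom R (F (Suc i)) (F i)"
    and "x \<in> carrier (F (Suc i)) \<Longrightarrow> reduce (phi i x) = \<iota> i (d i (cl (Suc i) x))" by auto
qed

lemma cl_phi: "x \<in> carrier (F (Suc i)) \<Longrightarrow> cl i (phi i x) = d i (cl (Suc i) x)"
  using reduce_phi pi_iota[OF module_hom_closed[OF P.d_hom cl_closed]] by (simp add: cl_def)

definition K :: "nat \<Rightarrow> ('a, nat \<Rightarrow> 'a) module" where
  "K i = (F i)\<lparr>carrier := {x \<in> carrier (F i). cl i x = \<zero>\<^bsub>P i\<^esub>}\<rparr>"

lemma mem_K: "x \<in> carrier (K i) \<longleftrightarrow> x \<in> carrier (F i) \<and> cl i x = \<zero>\<^bsub>P i\<^esub>"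
  by (simp add: K_def)

lemma K_ops [simp]:
  "x \<oplus>\<^bsub>K i\<^esub> y = x \<oplus>\<^bsub>F i\<^esub> y" "r \<odot>\<^bsub>K i\<^esub> x = r \<odot>\<^bsub>F i\<^esub> x" "\<zero>\<^bsub>K i\<^esub> = \<zero>\<^bsub>F i\<^esub>"
  by (simp_all add: K_def)

lemma K_module: "module R (K i)"
  using module_kernel[OF F_module Pr_module cl_hom] by (simp add: K_def)

lemma K_incl: "(\<lambda>x. x) \<in> module_hom R (K i) (F i)"
  by (rule module_homI) (simp_all add: mem_K)

lemma hom_into_K:
  assumes "f \<in> module_hom R A (F i)" "\<And>x. x \<in> carrier A \<Longrightarrow> cl i (f x) = \<zero>\<^bsub>P i\<^esub>"
  shows "f \<in> module_hom R A (K i)"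
  unfolding K_def using assms(2) module_hom_closed[OF assms(1)]
  by (intro module_hom_carrier_update_cod[OF assms(1)]) auto

text \<open>\<open>E i\<close> lifts the idempotent \<open>\<iota> i \<circ> \<pi> i\<close>. On the kernel of \<open>F i \<rightarrow> P i\<close> it is
  divisible by \<open>a\<close>, and \<open>E\<^sub>a i\<close> is the quotient.\<close>

lemma ex_E: "\<exists>E\<in>module_hom R (F i) (F i). \<exists>E\<^sub>a\<in>module_hom R (K i) (F i).
  (\<forall>x\<in>carrier (F i). reduce (E x) = \<iota> i (cl i x)) \<and>
  (\<forall>x\<in>carrier (K i). E x = a \<odot>\<^bsub>F i\<^esub> E\<^sub>a x)"
proof -
  obtain E where E: "E \<in> module_hom R (F i) (F i)"
      "\<And>x. x \<in> carrier (F i) \<Longrightarrow> reduce (E x) = \<iota> i (cl i x)"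
    using lift_along_reduce[OF module_hom_compose[OF cl_hom iota_hom[folded module_hom_restrict_scalars_iff]]]
    by metis
  have "reduce (E x) = \<zero>\<^bsub>free_module S {..<N i}\<^esub>" if "x \<in> carrier (K i)" for x
    using that E(2) module_hom_zero[OF P.P_module free_module_module[OF S_cring] iota_hom]
    by (simp add: mem_K)
  from divide_hom[OF K_module module_hom_compose[OF K_incl E(1)] this]
  obtain E\<^sub>a where "E\<^sub>a \<in> module_hom R (K i) (F i)" "\<And>x. x \<in> carrier (K i) \<Longrightarrow> E x = a \<odot>\<^bsub>F i\<^esub> E\<^sub>a x"
    by metis
  then show ?thesis using E by blast
qed

lemma cl_of_lift:
  assumes "reduce y = \<iota> i (cl i x)" "x \<in> carrier (F i)"
  shows "cl i y = cl i x"
  using assms pi_iota[OF cl_closed[OF assms(2)]] by (simp add: cl_def)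

text \<open>\<open>K i\<close> is a retract of \<open>F i\<close> times \<open>F i\<close>. The pair
  (u, v) goes to \<open>a u + (v - E v)\<close>, whose class is zero because \<open>v\<close> and
  \<open>E v\<close> have the same class. A section is \<open>x\<close> to
  (\<open>E\<^sub>a x\<close>, \<open>x\<close>), because \<open>E x\<close> is \<open>a\<close>
  times \<open>E\<^sub>a x\<close> on \<open>K i\<close>.\<close>

lemma K_fg_projective: "fg_projective R (K i)"
proof -
  from ex_E obtain E E\<^sub>a where E: "E \<in> module_hom R (F i) (F i)"
      "\<And>x. x \<in> carrier (F i) \<Longrightarrow> reduce (E x) = \<iota> i (cl i x)"
    and Ea: "E\<^sub>a \<in> module_hom R (K i) (F i)" "\<And>x. x \<in> carrier (K i) \<Longrightarrow> E x = a \<odot>\<^bsub>F i\<^esub> E\<^sub>a x"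
    by blast
  interpret F: module R "F i" by (rule F_module)
  let ?p = "\<lambda>x. a \<odot>\<^bsub>F i\<^esub> fst x \<oplus>\<^bsub>F i\<^esub> (snd x \<ominus>\<^bsub>F i\<^esub> E (snd x))"
  note au = module_hom_smult_fun[OF F_module a_closed module_hom_fst[of R "F i" "F i"]]
  note v_Ev = module_hom_minus_fun[OF F_module module_hom_snd[of R "F i" "F i"]
      module_hom_compose[OF module_hom_snd E(1)]]
  have "cl i (?p x) = \<zero>\<^bsub>P i\<^esub>" if x: "x \<in> carrier (prod_module (F i) (F i))" for x
  proof -
    have x2: "snd x \<in> carrier (F i)" and x1: "fst x \<in> carrier (F i)" using x by auto
    interpret Pi: module S "P i" by (rule P.P_module)
    have "cl i (snd x \<ominus>\<^bsub>F i\<^esub> E (snd x)) = \<zero>\<^bsub>P i\<^esub>"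
      using cl_of_lift[OF E(2)[OF x2] x2] module_hom_minus[OF F_module Pr_module cl_hom x2 module_hom_closed[OF E(1) x2]]
        cl_closed[OF x2] by (simp add: a_minus_eq_zero_iff[OF P.P_module])
    then show ?thesis
      using module_hom_add[OF cl_hom module_hom_closed[OF au x] module_hom_closed[OF v_Ev x]]
        cl_smult_a[OF x1] by simp
  qed
  then have p: "?p \<in> module_hom R (prod_module (F i) (F i)) (K i)"
    by (intro hom_into_K module_hom_add_fun[OF F_module au v_Ev])
  have j: "(\<lambda>x. (E\<^sub>a x, x)) \<in> module_hom R (K i) (prod_module (F i) (F i))"
    by (rule module_hom_Pair[OF Ea(1) K_incl])
  have "?p (E\<^sub>a x, x) = x" if x: "x \<in> carrier (K i)" for x
  proof -
    have xF: "x \<in> carrier (F i)" using x by (simp add: mem_K)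
    then show ?thesis
      using Ea(2)[OF x, symmetric] module_hom_closed[OF E(1) xF]
      by (simp add: a_minus_def F.M.a_lcomm[of _ x] F.M.r_neg del: free_module_simps)
  qed
  then show ?thesis
    by (rule fg_projective_retract[OF fg_projective_prod[OF fg_projective_free[OF R_cring]
            fg_projective_free[OF R_cring]] K_module j p])
qed

text \<open>Exactness provides \<open>u\<close> such that \<open>phi j u\<close> has the same class
  as \<open>x\<close>; the difference is then in \<open>K j\<close>. Together with
  \<open>cl_cover\<close> this determines the image of \<open>D\<close>.\<close>

lemma cover:
  assumes "x \<in> carrier (F j)" "cl j x \<in> Z j"
  obtains u v where "u \<in> carrier (F (Suc j))" "v \<in> carrier (K j)" "x = phi j u \<oplus>\<^bsub>F j\<^esub> v"
proof -
  interpret F: module R "F j" by (rule F_module)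
  from assms(2) obtain y where "y \<in> carrier (P (Suc j))" "cl j x = d j y"
    using P.d_image by blast
  then obtain u where u: "u \<in> carrier (F (Suc j))" "cl j x = d j (cl (Suc j) u)"
    using cl_surj[of "Suc j"] by (metis imageE restrict_scalars_simps(1))
  have ph: "phi j u \<in> carrier (F j)" by (rule module_hom_closed[OF phi_hom u(1)])
  define v where "v = x \<ominus>\<^bsub>F j\<^esub> phi j u"
  have vF: "v \<in> carrier (F j)" unfolding v_def by (rule F.M.minus_closed[OF assms(1) ph])
  have "cl j v = \<zero>\<^bsub>P j\<^esub>"
    using module_hom_minus[OF F_module Pr_module cl_hom assms(1) ph] cl_phi[OF u(1)] u(2)
      cl_closed[OF assms(1)] a_minus_eq_zero_iff[OF P.P_module] by (simp add: v_def del: free_module_simps)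
  moreover have "x = phi j u \<oplus>\<^bsub>F j\<^esub> v"
    using assms(1) ph F.M.a_lcomm[of "phi j u" x "\<ominus>\<^bsub>F j\<^esub> phi j u"]
    by (simp add: v_def a_minus_def F.M.r_neg del: free_module_simps)
  ultimately show thesis using that u(1) vF by (simp add: mem_K)
qed

lemma cl_cover:
  assumes "u \<in> carrier (F (Suc j))" "v \<in> carrier (K j)"
  shows "phi j u \<oplus>\<^bsub>F j\<^esub> v \<in> carrier (F j)" "cl j (phi j u \<oplus>\<^bsub>F j\<^esub> v) \<in> Z j"
proof -
  interpret F: module R "F j" by (rule F_module)
  interpret Pj: module S "P j" by (rule P.P_module)
  have ph: "phi j u \<in> carrier (F j)" by (rule module_hom_closed[OF phi_hom assms(1)])
  have v: "v \<in> carrier (F j)" "cl j v = \<zero>\<^bsub>P j\<^esub>" using assms(2) by (simp_all add: mem_K)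
  show "phi j u \<oplus>\<^bsub>F j\<^esub> v \<in> carrier (F j)" by (rule F.M.a_closed[OF ph v(1)])
  have "cl j (phi j u \<oplus>\<^bsub>F j\<^esub> v) = d j (cl (Suc j) u)"
    using module_hom_add[OF cl_hom ph v(1)] v(2) cl_phi[OF assms(1)]
      module_hom_closed[OF P.d_hom cl_closed[OF assms(1)]] by simp
  then show "cl j (phi j u \<oplus>\<^bsub>F j\<^esub> v) \<in> Z j" using P.d_cycles[OF cl_closed[OF assms(1)]] by simp
qed

text \<open>The terms of the resolution over \<open>R\<close>: the total complex of the resolutions
  \<open>K i \<rightarrow> F i\<close> of the \<open>P i\<close>.\<close>

definition K' :: "nat \<Rightarrow> ('a, nat \<Rightarrow> 'a) module" where
  "K' i = (case i of 0 \<Rightarrow> free_module R {} | Suc j \<Rightarrow> K j)"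

definition G :: "nat \<Rightarrow> ('a, (nat \<Rightarrow> 'a) \<times> (nat \<Rightarrow> 'a)) module" where
  "G i = prod_module (F i) (K' i)"

text \<open>Expanded, the second component is -phi(v) - phi(phi(u)): the usual sign of a total
  complex plus the correction for consecutive lifts not composing to zero. With both gathered in
  \<open>w\<close>, applying the next \<open>D\<close> cancels \<open>phi w\<close> against its
  negative.\<close>

definition D :: "nat \<Rightarrow> (nat \<Rightarrow> 'a) \<times> (nat \<Rightarrow> 'a) \<Rightarrow> (nat \<Rightarrow> 'a) \<times> (nat \<Rightarrow> 'a)" where
  "D i x = (let w = phi i (fst x) \<oplus>\<^bsub>F i\<^esub> snd x in
     (w, case i of 0 \<Rightarrow> (\<lambda>_. \<zero>\<^bsub>R\<^esub>) | Suc j \<Rightarrow> \<ominus>\<^bsub>F j\<^esub> phi j w))"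

lemma free_module_empty: "carrier (free_module R {}) = {\<lambda>_. \<zero>\<^bsub>R\<^esub>}"
  by (auto simp: mem_free_module fun_eq_iff)

lemma G_fg_projective: "fg_projective R (G i)"
  unfolding G_def K'_def
  using fg_projective_prod[OF fg_projective_free[OF R_cring] K_fg_projective]
    fg_projective_prod[OF fg_projective_free[OF R_cring]
      fg_projective_zero[OF free_module_module[OF R_cring], of "{}"]]
  by (auto simp: free_module_empty split: nat.split)

lemma G_module: "module R (G i)"
  by (rule fg_projective_imp_module[OF G_fg_projective])

text \<open>Degree \<open>Suc m\<close> still contains \<open>K m\<close>; this is the one extra
  step of length over \<open>R\<close>.\<close>

lemma G_zero:
  assumes "Suc m < i"
  shows "carrier (G i) = {\<zero>\<^bsub>G i\<^esub>}"
proof -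
  obtain j where i: "i = Suc j" and j: "m < j" using assms by (cases i) auto
  have "carrier (K j) = {\<zero>\<^bsub>F j\<^esub>}"
    using j cl_zero[of j] by (auto simp: K_def N_zero free_module_empty)
  then show ?thesis
    using assms j by (simp add: G_def K'_def i N_zero free_module_empty)
qed

lemma phi_K:
  assumes "w \<in> carrier (F (Suc j))" "cl (Suc j) w \<in> Z (Suc j)"
  shows "\<ominus>\<^bsub>F j\<^esub> phi j w \<in> carrier (K j)"
proof -
  interpret F: module R "F j" by (rule F_module)
  interpret Pj: module S "P j" by (rule P.P_module)
  have ph: "phi j w \<in> carrier (F j)" by (rule module_hom_closed[OF phi_hom assms(1)])
  then show ?thesis
    using module_hom_uminus[OF F_module Pr_module cl_hom ph] cl_phi[OF assms(1)] assms(2)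
    by (simp add: mem_K)
qed

lemma mem_G: "(u, v) \<in> carrier (G (Suc i)) \<longleftrightarrow> u \<in> carrier (F (Suc i)) \<and> v \<in> carrier (K i)"
  by (simp add: G_def K'_def)

lemma D_hom: "D i \<in> module_hom R (G (Suc i)) (G i)"
proof -
  have G: "G (Suc i) = prod_module (F (Suc i)) (K i)" by (simp add: G_def K'_def)
  let ?w = "\<lambda>x. phi i (fst x) \<oplus>\<^bsub>F i\<^esub> snd x"
  have w: "?w \<in> module_hom R (G (Suc i)) (F i)"
    unfolding G by (intro module_hom_add_fun[OF F_module] module_hom_compose[OF module_hom_fst phi_hom]
        module_hom_compose[OF module_hom_snd K_incl])
  show ?thesis
  proof (cases i)
    case 0
    have "(\<lambda>x. (?w x, \<zero>\<^bsub>free_module R ({} :: nat set)\<^esub>)) \<in> module_hom R (G (Suc i)) (prod_module (F i) (free_module R {}))"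
      by (rule module_hom_Pair[OF w module_hom_const_zero[OF free_module_module[OF R_cring]]])
    moreover have "D i = (\<lambda>x. (?w x, \<zero>\<^bsub>free_module R ({} :: nat set)\<^esub>))"
      using 0 by (simp add: D_def Let_def fun_eq_iff)
    ultimately show ?thesis using 0 by (simp add: G_def K'_def)
  next
    case (Suc j)
    have "(\<lambda>x. \<ominus>\<^bsub>F j\<^esub> phi j (?w x)) \<in> module_hom R (G (Suc i)) (F j)"
      using w unfolding Suc by (intro module_hom_uminus_fun[OF F_module] module_hom_compose[OF _ phi_hom])
    moreover have "\<ominus>\<^bsub>F j\<^esub> phi j (?w x) \<in> carrier (K j)" if "x \<in> carrier (G (Suc i))" for x
      using phi_K cl_cover[of "fst x" i "snd x"] that by (cases x) (simp add: mem_G Suc)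
    ultimately have "(\<lambda>x. \<ominus>\<^bsub>F j\<^esub> phi j (?w x)) \<in> module_hom R (G (Suc i)) (K j)"
      by (intro hom_into_K) (auto simp: mem_K)
    from module_hom_Pair[OF w this] have "(\<lambda>x. (?w x, \<ominus>\<^bsub>F j\<^esub> phi j (?w x))) \<in> module_hom R (G (Suc i)) (G i)"
      by (simp add: G_def K'_def Suc)
    moreover have "D i = (\<lambda>x. (?w x, \<ominus>\<^bsub>F j\<^esub> phi j (?w x)))"
      by (simp add: D_def Let_def fun_eq_iff Suc)
    ultimately show ?thesis by simp
  qed
qed

definition aug :: "(nat \<Rightarrow> 'a) \<times> (nat \<Rightarrow> 'a) \<Rightarrow> 'b" where
  "aug x = e (cl 0 (fst x))"

lemma cycles_G_0: "cycles G D aug (restrict_scalars M) 0 =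
    {(w, \<lambda>_. \<zero>\<^bsub>R\<^esub>) | w. w \<in> carrier (F 0) \<and> cl 0 w \<in> Z 0}"
  using cl_closed[of _ 0] by (auto simp: G_def K'_def aug_def free_module_empty)

text \<open>A cycle (w, v) has v equal to the negative of \<open>phi i w\<close>, and v lying in
  \<open>K i\<close> says precisely that the class of \<open>w\<close> is a cycle of
  \<open>P\<close>. So the cycles form a graph over such \<open>w\<close>.\<close>

lemma cycles_G_Suc: "cycles G D aug (restrict_scalars M) (Suc i) =
    {(w, \<ominus>\<^bsub>F i\<^esub> phi i w) | w. w \<in> carrier (F (Suc i)) \<and> cl (Suc i) w \<in> Z (Suc i)}"
    (is "?A = ?B")
proof -
  interpret F: module R "F i" by (rule F_module)
  interpret Pi: module S "P i" by (rule P.P_module)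
  \<comment> \<open>The second component is a function of the first and vanishes along with
    it.\<close>
  have D0: "D i (w, v) = \<zero>\<^bsub>G i\<^esub> \<longleftrightarrow> phi i w \<oplus>\<^bsub>F i\<^esub> v = \<zero>\<^bsub>F i\<^esub>" for w v
  proof (cases i)
    case (Suc j)
    interpret Fj: module R "F j" by (rule F_module)
    have "\<ominus>\<^bsub>F j\<^esub> phi j \<zero>\<^bsub>F i\<^esub> = \<zero>\<^bsub>F j\<^esub>"
      using module_hom_zero[OF F_module F_module phi_hom, of j]
        Fj.M.minus_equality[OF Fj.M.l_zero[OF Fj.M.zero_closed] Fj.M.zero_closed Fj.M.zero_closed]
      by (simp only: Suc)
    then show ?thesis by (auto simp: D_def G_def K'_def Let_def Suc)
  qed (simp add: D_def G_def K'_def)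
  show ?thesis
  proof (intro equalityI subsetI)
    fix x assume "x \<in> ?A"
    then obtain w v where x: "x = (w, v)" and w: "w \<in> carrier (F (Suc i))" and v: "v \<in> carrier (K i)"
        and eq: "phi i w \<oplus>\<^bsub>F i\<^esub> v = \<zero>\<^bsub>F i\<^esub>"
      using D0 by (cases x) (auto simp: mem_G simp del: free_module_simps)
    have ph: "phi i w \<in> carrier (F i)" by (rule module_hom_closed[OF phi_hom w])
    have vF: "v \<in> carrier (F i)" "cl i v = \<zero>\<^bsub>P i\<^esub>" using v by (simp_all add: mem_K)
    have v_eq: "v = \<ominus>\<^bsub>F i\<^esub> phi i w"
      using F.M.minus_equality[of v "phi i w"] eq ph vF F.M.a_comm[OF vF(1) ph]
      by (simp del: free_module_simps)
    have "d i (cl (Suc i) w) = \<zero>\<^bsub>P i\<^esub>"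
      using module_hom_add[OF cl_hom ph vF(1)] vF(2) cl_phi[OF w] cl_zero[of i] eq
        module_hom_closed[OF P.d_hom cl_closed[OF w]] by (simp del: free_module_simps)
    then show "x \<in> ?B" using x w v_eq cl_closed[OF w] by simp
  next
    fix x assume "x \<in> ?B"
    then obtain w where x: "x = (w, \<ominus>\<^bsub>F i\<^esub> phi i w)" and w: "w \<in> carrier (F (Suc i))"
        "cl (Suc i) w \<in> Z (Suc i)" by blast
    then show "x \<in> ?A"
      using D0 phi_K[OF w] F.M.r_neg[OF module_hom_closed[OF phi_hom w(1)]]
      by (simp add: mem_G del: free_module_simps)
  qed
qed

text \<open>Cycles and boundaries are graphs of the same function \<open>c\<close>, so exactness
  reduces to their first components, which \<open>cover\<close> and \<open>cl_cover\<close>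
  identify.\<close>

lemma G_resolution: "finite_resolution R (Suc m) G D aug (restrict_scalars M)"
  unfolding finite_resolution_iff
proof (intro conjI allI impI G_module restrict_scalars_module P.M_module G_zero D_hom)
  have G0: "G 0 = prod_module (F 0) (free_module R {})" by (simp add: G_def K'_def)
  show "aug \<in> module_hom R (G 0) (restrict_scalars M)"
    using module_hom_compose[OF module_hom_fst module_hom_compose[OF cl_hom
          P.e_hom[folded module_hom_restrict_scalars_iff]]]
    unfolding G0 aug_def[abs_def] .
  have "aug ` carrier (G 0) = e ` (cl 0 ` carrier (F 0))"
    by (force simp: G0 aug_def free_module_empty)
  then show "aug ` carrier (G 0) = carrier (restrict_scalars M)"
    using P.e_surj cl_surj[of 0] by simp
  show "D j ` carrier (G (Suc j)) = cycles G D aug (restrict_scalars M) j" for j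
  proof -
    define c where "c = (\<lambda>w. case j of 0 \<Rightarrow> (\<lambda>_. \<zero>\<^bsub>R\<^esub>) | Suc i \<Rightarrow> \<ominus>\<^bsub>F i\<^esub> phi i w)"
    have "D j ` carrier (G (Suc j)) = {(w, c w) | w. w \<in> carrier (F j) \<and> cl j w \<in> Z j}"
    proof (intro equalityI subsetI)
      fix x assume "x \<in> D j ` carrier (G (Suc j))"
      then obtain u v where "u \<in> carrier (F (Suc j))" "v \<in> carrier (K j)" "x = D j (u, v)"
        using mem_G by auto
      then show "x \<in> {(w, c w) | w. w \<in> carrier (F j) \<and> cl j w \<in> Z j}"
        using cl_cover[of u j v] by (simp add: D_def c_def Let_def del: free_module_simps)
    next
      fix x assume "x \<in> {(w, c w) | w. w \<in> carrier (F j) \<and> cl j w \<in> Z j}"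
      then obtain w where w: "x = (w, c w)" "w \<in> carrier (F j)" "cl j w \<in> Z j" by blast
      then obtain u v where "u \<in> carrier (F (Suc j))" "v \<in> carrier (K j)" "w = phi j u \<oplus>\<^bsub>F j\<^esub> v"
        using cover by metis
      then show "x \<in> D j ` carrier (G (Suc j))"
        using w(1) by (intro image_eqI[of _ _ "(u, v)"]) (auto simp: D_def c_def Let_def mem_G)
    qed
    also have "\<dots> = cycles G D aug (restrict_scalars M) j"
      unfolding c_def by (cases j) (simp_all only: nat.case cycles_G_0 cycles_G_Suc)
    finally show ?thesis .
  qed
qed

text \<open>In degree \<open>m\<close> the cycles of \<open>G\<close> are a copy of
  \<open>K m\<close>, and the short resolution supplies a retraction \<open>r\<close> onto them.
  From \<open>r\<close> a map \<open>g\<close> is made such that \<open>g\<close> after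
  \<open>\<iota> k\<close> is a left inverse of \<open>d k\<close>; following it by
  \<open>d k\<close> projects \<open>P k\<close> onto its cycles.\<close>

lemma short_resolution_imp_split:
  assumes Q: "finite_resolution R n Q d' e' (restrict_scalars M)" "\<And>i. projective R (Q i)"
    and m: "m = Suc k" "n \<le> m"
  obtains s where "s \<in> module_hom S (P k) (P k)"
    "\<And>x. x \<in> carrier (P k) \<Longrightarrow> s x \<in> Z k" "\<And>x. x \<in> Z k \<Longrightarrow> s x = x"
proof -
  let ?C = "cycles G D aug (restrict_scalars M)"
  obtain r where r: "r \<in> module_hom R (G m) (G m)" "\<And>x. x \<in> carrier (G m) \<Longrightarrow> r x \<in> ?C m"
      "\<And>x. x \<in> ?C m \<Longrightarrow> r x = x"
    using cycles_retract[OF G_resolution fg_projective_imp_projective[OF G_fg_projective] Q m(2)] by metis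
  obtain E E\<^sub>a where E: "E \<in> module_hom R (F m) (F m)"
      "\<And>x. x \<in> carrier (F m) \<Longrightarrow> reduce (E x) = \<iota> m (cl m x)"
    and Ea: "E\<^sub>a \<in> module_hom R (K m) (F m)" "\<And>x. x \<in> carrier (K m) \<Longrightarrow> E x = a \<odot>\<^bsub>F m\<^esub> E\<^sub>a x"
    using ex_E[of m] by blast
  interpret Fk: module R "F k" by (rule F_module)
  interpret Fm: module R "F m" by (rule F_module)
  interpret Pk: module S "P k" by (rule P.P_module)
  interpret Pm: module S "P m" by (rule P.P_module)
  have Gm: "G m = prod_module (F m) (K k)" by (simp add: G_def K'_def m)
  \<comment> \<open>\<open>P\<close> has no nonzero cycles in its top degree \<open>m\<close>, so
    the first component of a cycle of \<open>G\<close> has class zero.\<close>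
  have fst_r: "fst (r x) \<in> carrier (K m)" if "x \<in> carrier (G m)" for x
  proof -
    have "r x \<in> ?C (Suc k)" using r(2)[OF that] by (simp only: m(1))
    then have "fst (r x) \<in> carrier (F m) \<and> cl m (fst (r x)) \<in> Z m"
      unfolding cycles_G_Suc m(1) by auto
    then show ?thesis using P.cycles_above[of m] by (simp add: mem_K)
  qed
  \<comment> \<open>The factor \<open>a\<close> pushes \<open>F k\<close> into \<open>K k\<close>,
    the second factor of \<open>G m\<close>, where \<open>r\<close> can be applied; the sign matches
    the one in the cycles of \<open>G\<close>.\<close>
  define y' where "y' = (\<lambda>y. \<ominus>\<^bsub>F k\<^esub> (a \<odot>\<^bsub>F k\<^esub> y))"
  have y'F: "y' \<in> module_hom R (F k) (F k)"
    unfolding y'_def by (rule module_hom_uminus_fun[OF F_module module_hom_smult_fun[OF F_module a_closed module_hom_id]])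
  have "cl k (y' y) = \<zero>\<^bsub>P k\<^esub>" if "y \<in> carrier (F k)" for y
    using module_hom_uminus[OF F_module Pr_module cl_hom Fk.smult_closed[OF a_closed that]] cl_smult_a[OF that]
    by (simp add: y'_def del: free_module_simps)
  then have y'K: "y' \<in> module_hom R (F k) (K k)" by (rule hom_into_K[OF y'F])
  define t where "t = (\<lambda>y. fst (r (\<zero>\<^bsub>F m\<^esub>, y' y)))"
  have pair: "(\<lambda>y. (\<zero>\<^bsub>F m\<^esub>, y' y)) \<in> module_hom R (F k) (G m)"
    unfolding Gm by (rule module_hom_Pair[OF module_hom_const_zero[OF F_module] y'K])
  have fst_hom: "fst \<in> module_hom R (G m) (F m)" unfolding Gm by (rule module_hom_fst)
  have tK: "t y \<in> carrier (K m)" if "y \<in> carrier (F k)" for y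
    unfolding t_def by (rule fst_r[OF module_hom_closed[OF pair that]])
  have t: "t \<in> module_hom R (F k) (K m)"
    using module_hom_compose[OF module_hom_compose[OF pair r(1)] fst_hom] tK
    by (intro hom_into_K) (auto simp: t_def[abs_def] mem_K)
  \<comment> \<open>\<open>t y\<close> need not be divisible by \<open>a\<close> in
    \<open>F m\<close>, and \<open>E\<^sub>a\<close> replaces the division: on a multiple
    \<open>a z\<close> it returns \<open>E z\<close>, whose class is that of
    \<open>z\<close>.\<close>
  define \<theta> where "\<theta> = (\<lambda>y. cl m (E\<^sub>a (t y)))"
  have \<theta>: "\<theta> \<in> module_hom R (F k) (Pr m)"
    unfolding \<theta>_def by (rule module_hom_compose[OF module_hom_compose[OF t Ea(1)] cl_hom])
  \<comment> \<open>\<open>E\<^sub>a\<close> after \<open>t\<close> is linear on all of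
    \<open>F k\<close>, so multiples of \<open>a\<close> go to multiples of \<open>a\<close>, which
    have class zero. Hence \<open>\<theta>\<close> descends to the quotient.\<close>
  have "\<theta> x = \<zero>\<^bsub>Pr m\<^esub>" if x: "x \<in> carrier (F k)" "reduce x = \<zero>\<^bsub>restrict_scalars (free_module S {..<N k})\<^esub>" for x
  proof -
    obtain z where z: "z \<in> carrier (F k)" "x = a \<odot>\<^bsub>F k\<^esub> z"
      using reduce_eq_zero[OF x(1)] x(2) by (metis restrict_scalars_simps(2))
    have "E\<^sub>a (t x) = a \<odot>\<^bsub>F m\<^esub> E\<^sub>a (t z)"
      using module_hom_smult[OF module_hom_compose[OF t Ea(1)] a_closed z(1)] z(2) by metis
    then show ?thesis
      using cl_smult_a[OF module_hom_closed[OF Ea(1) tK[OF z(1)]]] by (simp add: \<theta>_def del: free_module_simps)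
  qed
  from module_hom_factor[OF F_module restrict_scalars_module[OF free_module_module[OF S_cring]] Pr_module
      reduce_hom reduce_surj \<theta> this]
  obtain g where g: "g \<in> module_hom S (free_module S {..<N k}) (P m)"
      "\<And>x. x \<in> carrier (F k) \<Longrightarrow> g (reduce x) = \<theta> x"
    unfolding module_hom_restrict_scalars_iff by metis
  have \<theta>_phi: "\<theta> (phi k w) = cl m w" if w: "w \<in> carrier (F m)" for w
  proof -
    have ph: "phi k w \<in> carrier (F k)" using module_hom_closed[OF phi_hom] w m(1) by simp
    \<comment> \<open>Multiplication by \<open>a\<close> gives \<open>w\<close> class zero, so
      (\<open>aw\<close>, \<open>y' (phi k w)\<close>) is a cycle and fixed by \<open>r\<close>. It
      is also \<open>a\<close> times (w, 0) plus (0, \<open>y' (phi k w)\<close>); applying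
      \<open>r\<close> to both descriptions and comparing first components expresses
      \<open>t (phi k w)\<close> as a multiple of \<open>a\<close>.\<close>
    define aw where "aw = a \<odot>\<^bsub>F m\<^esub> w"
    have awF: "aw \<in> carrier (F m)" unfolding aw_def by (rule Fm.smult_closed[OF a_closed w])
    have phi_aw: "\<ominus>\<^bsub>F k\<^esub> phi k aw = y' (phi k w)"
      using module_hom_smult[OF phi_hom a_closed, of w k] w by (simp add: aw_def y'_def m(1) del: free_module_simps)
    have "cl m aw \<in> Z m" using cl_smult_a[OF w] P.zero_in_cycles by (simp add: aw_def del: free_module_simps)
    then have "(aw, y' (phi k w)) \<in> ?C m"
      using awF unfolding phi_aw[symmetric] m(1) cycles_G_Suc by blast
    then have r_aw: "r (aw, y' (phi k w)) = (aw, y' (phi k w))" by (rule r(3))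
    have w0: "(w, \<zero>\<^bsub>K k\<^esub>) \<in> carrier (G m)"
      using w module.axioms(2)[OF K_module[of k]]
      by (simp add: Gm abelian_groupE(2) del: free_module_simps K_ops)
    interpret Gm: module R "G m" by (rule G_module)
    interpret Kk: module R "K k" by (rule K_module)
    define s where "s = fst (r (w, \<zero>\<^bsub>K k\<^esub>))"
    have s: "s \<in> carrier (F m)" "cl m s = \<zero>\<^bsub>P m\<^esub>" using fst_r[OF w0] by (simp_all add: s_def mem_K)
    have y'pK: "y' (phi k w) \<in> carrier (K k)" by (rule module_hom_closed[OF y'K ph])
    have "(aw, y' (phi k w)) = a \<odot>\<^bsub>G m\<^esub> (w, \<zero>\<^bsub>K k\<^esub>) \<oplus>\<^bsub>G m\<^esub> (\<zero>\<^bsub>F m\<^esub>, y' (phi k w))"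
      using Fm.M.r_zero[OF awF] Kk.M.l_zero[OF y'pK] Kk.smult_r_null[OF a_closed]
      by (simp add: Gm aw_def del: free_module_simps K_ops)
    then have "fst (r (aw, y' (phi k w))) = a \<odot>\<^bsub>F m\<^esub> s \<oplus>\<^bsub>F m\<^esub> t (phi k w)"
      using module_hom_add[OF module_hom_compose[OF r(1) fst_hom] Gm.smult_closed[OF a_closed w0] module_hom_closed[OF pair ph]]
        module_hom_smult[OF module_hom_compose[OF r(1) fst_hom] a_closed w0]
      by (simp add: s_def t_def del: free_module_simps K_ops)
    then have eq: "aw = a \<odot>\<^bsub>F m\<^esub> s \<oplus>\<^bsub>F m\<^esub> t (phi k w)" using r_aw by simp
    have tF: "t (phi k w) \<in> carrier (F m)" using tK[OF ph] by (simp add: mem_K)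
    have asF: "a \<odot>\<^bsub>F m\<^esub> s \<in> carrier (F m)" by (rule Fm.smult_closed[OF a_closed s(1)])
    have ws: "w \<ominus>\<^bsub>F m\<^esub> s \<in> carrier (F m)" by (rule Fm.M.minus_closed[OF w s(1)])
    have "t (phi k w) = aw \<ominus>\<^bsub>F m\<^esub> a \<odot>\<^bsub>F m\<^esub> s"
      unfolding eq a_minus_def using asF tF
      by (simp add: Fm.M.a_comm[of "a \<odot>\<^bsub>F m\<^esub> s" "t (phi k w)"] Fm.M.a_assoc Fm.M.r_neg del: free_module_simps)
    also have "\<dots> = a \<odot>\<^bsub>F m\<^esub> (w \<ominus>\<^bsub>F m\<^esub> s)"
      unfolding aw_def a_minus_def
      using Fm.smult_r_distr[OF a_closed w Fm.M.a_inv_closed[OF s(1)]] Fm.smult_r_minus[OF a_closed s(1)] by metis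
    finally have t_eq: "t (phi k w) = a \<odot>\<^bsub>F m\<^esub> (w \<ominus>\<^bsub>F m\<^esub> s)" .
    have "a \<odot>\<^bsub>F m\<^esub> E\<^sub>a (t (phi k w)) = a \<odot>\<^bsub>F m\<^esub> E (w \<ominus>\<^bsub>F m\<^esub> s)"
      using Ea(2)[OF tK[OF ph]] module_hom_smult[OF E(1) a_closed ws] t_eq by metis
    then have "E\<^sub>a (t (phi k w)) = E (w \<ominus>\<^bsub>F m\<^esub> s)"
      by (rule smult_a_cancel[OF module_hom_closed[OF Ea(1) tK[OF ph]] module_hom_closed[OF E(1) ws]])
    then have "\<theta> (phi k w) = cl m (w \<ominus>\<^bsub>F m\<^esub> s)"
      using cl_of_lift[OF E(2)[OF ws] ws] by (simp add: \<theta>_def)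
    also have "\<dots> = cl m w"
      using module_hom_minus[OF F_module Pr_module cl_hom w s(1)] s(2) cl_closed[OF w]
      by (simp add: a_minus_def)
    finally show ?thesis .
  qed
  have Pm: "P m = P (Suc k)" by (simp only: m(1))
  note gi = module_hom_compose[OF iota_hom[of k] g(1)]
  note dg = module_hom_compose[OF gi[unfolded Pm] P.d_hom[of k]]
  show thesis
  proof (rule that[OF dg])
    show "d k (g (\<iota> k x)) \<in> Z k" if "x \<in> carrier (P k)" for x
      using P.d_cycles[OF module_hom_closed[OF gi that, unfolded Pm]] .
    fix x assume "x \<in> Z k"
    then obtain w where w: "w \<in> carrier (F m)" "x = d k (cl m w)"
      using P.d_image[of k] cl_surj[of "Suc k"] m(1) by (metis imageE restrict_scalars_simps(1))
    have "\<iota> k x = reduce (phi k w)" using reduce_phi[of w k] w m(1) by simp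
    then have "g (\<iota> k x) = cl m w"
      using g(2) \<theta>_phi[OF w(1)] module_hom_closed[OF phi_hom, of w k] w(1) m(1) by simp
    then show "d k (g (\<iota> k x)) = x" using w(2) by simp
  qed
qed

text \<open>For every \<open>w\<close> in \<open>F 0\<close> the pair (a w, 0) is a cycle, so the
  retraction fixes it. By linearity and cancellation of \<open>a\<close> it fixes (w, 0) too, so the
  class of \<open>w\<close> is a cycle of \<open>P\<close>; for \<open>m = 0\<close> only zero is
  one.\<close>

lemma projective_imp_zero:
  assumes Q: "finite_resolution R 0 Q d' e' (restrict_scalars M)" "\<And>i. projective R (Q i)"
    and m: "m = 0"
  shows "carrier M = {\<zero>\<^bsub>M\<^esub>}"
proof -
  let ?C = "cycles G D aug (restrict_scalars M)"
  obtain r where r: "r \<in> module_hom R (G 0) (G 0)" "\<And>x. x \<in> carrier (G 0) \<Longrightarrow> r x \<in> ?C 0"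
      "\<And>x. x \<in> ?C 0 \<Longrightarrow> r x = x"
    using cycles_retract[OF G_resolution fg_projective_imp_projective[OF G_fg_projective] Q le_refl] by metis
  interpret F: module R "F 0" by (rule F_module)
  have G0: "G 0 = prod_module (F 0) (free_module R {})" by (simp add: G_def K'_def)
  have "cl 0 w = \<zero>\<^bsub>P 0\<^esub>" if w: "w \<in> carrier (F 0)" for w
  proof -
    let ?z = "\<lambda>_ :: nat. \<zero>\<^bsub>R\<^esub>"
    have w0: "(w, ?z) \<in> carrier (G 0)" using w by (simp add: G0 free_module_empty)
    obtain w' where w': "r (w, ?z) = (w', ?z)" "w' \<in> carrier (F 0)" "cl 0 w' \<in> Z 0"
      using r(2)[OF w0] unfolding cycles_G_0 by blast
    have az: "a \<odot>\<^bsub>G 0\<^esub> (x, ?z) = (a \<odot>\<^bsub>F 0\<^esub> x, ?z)" for x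
      using a_closed by (simp add: G0)
    have "(a \<odot>\<^bsub>F 0\<^esub> w, ?z) \<in> ?C 0"
      using F.smult_closed[OF a_closed w] cl_smult_a[OF w] P.zero_in_cycles[of 0]
      unfolding cycles_G_0 by auto
    then have "(a \<odot>\<^bsub>F 0\<^esub> w, ?z) = a \<odot>\<^bsub>G 0\<^esub> r (w, ?z)"
      using r(3) module_hom_smult[OF r(1) a_closed w0] az by metis
    then have "a \<odot>\<^bsub>F 0\<^esub> w = a \<odot>\<^bsub>F 0\<^esub> w'" using w'(1) az by (metis prod.inject)
    then have "w = w'" by (rule smult_a_cancel[OF w w'(2)])
    then show ?thesis using w'(3) P.cycles_above[of 0] m by (simp del: cycles_simps)
  qed
  then have "carrier (P 0) = {\<zero>\<^bsub>P 0\<^esub>}"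
    using cl_surj[of 0] cl_zero[of 0] F.M.zero_closed by fastforce
  then show ?thesis
    using P.e_surj module_hom_zero[OF P.P_module P.M_module P.e_hom] by simp
qed

end

text \<open>Used to carry a short resolution of a transported copy back to the original
  module.\<close>

lemma resolution_iso:
  assumes res: "finite_resolution R n P d e M" and "module R M'"
    and g: "g \<in> module_hom R M M'" "inj_on g (carrier M)" "g ` carrier M = carrier M'"
  shows "finite_resolution R n P d (\<lambda>x. g (e x)) M'"
proof -
  interpret P: resolution R n P d e M by unfold_locales (rule res)
  interpret M: module R M by (rule P.M_module)
  have "g (e x) = \<zero>\<^bsub>M'\<^esub> \<longleftrightarrow> e x = \<zero>\<^bsub>M\<^esub>" if "x \<in> carrier (P 0)" for x
    using inj_on_eq_iff[OF g(2) module_hom_closed[OF P.e_hom that] M.M.zero_closed]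
    by (simp only: module_hom_zero[OF P.M_module assms(2) g(1)])
  then have "cycles P d (\<lambda>x. g (e x)) M' j = cycles P d e M j" for j
    by (cases j) (simp_all cong: conj_cong)
  moreover have "(\<lambda>x. g (e x)) ` carrier (P 0) = carrier M'"
    using P.e_surj g(3) by (metis image_image)
  ultimately show ?thesis
    unfolding finite_resolution_iff
    by (intro conjI allI impI P.P_module assms(2) P.P_zero P.d_hom module_hom_compose[OF P.e_hom g(1)])
      (simp_all only: P.d_image)
qed

lemma projective_resolution_all:
  assumes "finite_resolution R n P d e M" "\<forall>i\<le>n. projective R (P i)"
  shows "projective R (P i)"
  using assms projective_zero[of R "P i"] unfolding finite_resolution_iff by (metis not_le)

text \<open>The infimum of a nonempty set of extended naturals is attained, so a finite bound
  produces an actual resolution. Its terms beyond the length are zero, hence projective in every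
  degree.\<close>

lemma pd_le_iff:
  fixes M :: "('a, 'b) module"
  shows "pd R M \<le> enat m \<longleftrightarrow>
    (\<exists>n\<le>m. \<exists>(P :: nat \<Rightarrow> ('a, ('a, 'b) res_carrier) module) d e.
       finite_resolution R n P d e M \<and> (\<forall>i. projective R (P i)))"
proof -
  define A where "A = {enat n | n. \<exists>(P :: nat \<Rightarrow> ('a, ('a, 'b) res_carrier) module) d e.
     finite_resolution R n P d e M \<and> (\<forall>i\<le>n. projective R (P i))}"
  have mem_A: "enat n \<in> A \<longleftrightarrow> (\<exists>(P :: nat \<Rightarrow> ('a, ('a, 'b) res_carrier) module) d e.
       finite_resolution R n P d e M \<and> (\<forall>i. projective R (P i)))" for n
    unfolding A_def using projective_resolution_all by blast
  have A: "x \<in> A \<Longrightarrow> \<exists>n. x = enat n" for x unfolding A_def by blast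
  have "Inf A \<le> enat m \<longleftrightarrow> (\<exists>n\<le>m. enat n \<in> A)"
  proof
    assume le: "Inf A \<le> enat m"
    then have "A \<noteq> {}" by (metis Inf_enat_def enat_ord_code(5))
    then have "Inf A \<in> A" by (metis Inf_enat_def LeastI ex_in_conv)
    then show "\<exists>n\<le>m. enat n \<in> A" using le A by (metis enat_ord_simps(1))
  next
    assume "\<exists>n\<le>m. enat n \<in> A"
    then show "Inf A \<le> enat m" by (meson Inf_lower enat_ord_simps(1) order_trans)
  qed
  then show ?thesis unfolding mem_A by (simp only: pd_def A_def)
qed

subsection \<open>Finitistic dimension\<close>

text \<open>The two sequences are interleaved: the value at a list depends on its length alone, even
  lengths reading the first sequence and odd ones the second.\<close>

lemma ex_inj_pair_to_list_fun: "\<exists>J :: (nat \<Rightarrow> 'a) \<times> (nat \<Rightarrow> 'a) \<Rightarrow> 'l list \<Rightarrow> 'a. inj J"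
proof
  let ?J = "\<lambda>(x :: nat \<Rightarrow> 'a, y) (l :: 'l list).
    if even (length l) then x (length l div 2) else y (length l div 2)"
  show "inj ?J"
  proof (rule injI)
    fix p p' assume eq: "?J p = ?J p'"
    have "fst p i = fst p' i" "snd p i = snd p' i" for i
      using fun_cong[OF eq, of "replicate (2 * i) undefined"]
        fun_cong[OF eq, of "replicate (Suc (2 * i)) undefined"]
      by (auto simp: case_prod_beta)
    then show "p = p'" by (auto simp: prod_eq_iff fun_eq_iff)
  qed
qed

lemma fg_projective_all:
  assumes "finite_resolution R n P d e M" "\<forall>i\<le>n. projective R (P i) \<and> fin_gen R (P i)"
  shows "fg_projective R (P i)"
  using assms fg_projectiveI[of R "P i"] fg_projective_zero[of R "P i"]
  unfolding finite_resolution_iff by (metis not_le)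

text \<open>Interface to the preceding construction: \<open>M'\<close> is a copy of \<open>M\<close>
  as an \<open>R\<close>-module in the carrier type over which \<open>fPD\<close> ranges, and the
  last two clauses state what a dimension of at most \<open>m\<close> over \<open>R\<close> would
  force over \<open>S\<close>.\<close>

lemma change_of_rings:
  fixes R :: "('a, 'r) ring_scheme" and M :: "('c, 'b) module"
  assumes quot: "regular_quotient R S q a"
    and res: "finite_resolution S m P d e M" and proj: "\<And>i. fg_projective S (P i)"
  obtains M' :: "('a, (nat \<Rightarrow> 'a) set) module"
  where "M' \<in> FPR R"
    "pd R M' \<le> enat m \<Longrightarrow> m = 0 \<Longrightarrow> carrier M = {\<zero>\<^bsub>M\<^esub>}"
    "\<And>k. pd R M' \<le> enat m \<Longrightarrow> m = Suc k \<Longrightarrow>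
       \<exists>s\<in>module_hom S (P k) (P k). (\<forall>x\<in>carrier (P k). s x \<in> cycles P d e M k) \<and>
         (\<forall>x\<in>cycles P d e M k. s x = x)"
proof -
  interpret P: resolution S m P d e M by unfold_locales (rule res)
  have "\<exists>n i p. i \<in> module_hom S (P j) (free_module S {..<n::nat}) \<and>
      p \<in> module_hom S (free_module S {..<n}) (P j) \<and> (\<forall>x\<in>carrier (P j). p (i x) = x) \<and>
      (m < j \<longrightarrow> n = 0)" for j
  proof (cases "m < j")
    \<comment> \<open>Rank 0 is chosen explicitly here, as \<open>N_zero\<close> demands.\<close>
    case True
    note free = free_module_module[OF regular_quotient.S_cring[OF quot], of "{..<0::nat}"]
    show ?thesis
      using module_hom_const_zero[OF free, of "P j"] module_hom_const_zero[OF P.P_module, of j "free_module S {..<0::nat}"]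
        P.P_zero[OF True] by (metis singletonD)
  next
    case False
    then show ?thesis using proj[of j] unfolding fg_projective_def by blast
  qed
  then obtain N \<iota> \<pi> where "\<And>i. \<iota> i \<in> module_hom S (P i) (free_module S {..<N i :: nat})"
      "\<And>i. \<pi> i \<in> module_hom S (free_module S {..<N i}) (P i)"
      "\<And>i x. x \<in> carrier (P i) \<Longrightarrow> \<pi> i (\<iota> i x) = x" "\<And>i. m < i \<Longrightarrow> N i = 0"
    by metis
  then interpret projective_resolution_over_quotient R S q a m P d e M N \<iota> \<pi>
    using quot P.resolution_axioms
    by (intro projective_resolution_over_quotient.intro projective_resolution_over_quotient_axioms.intro)
  let ?M = "restrict_scalars M"
  \<comment> \<open>An element of \<open>M\<close> is represented by its fibre in
    \<open>F 0\<close>, a set of functions from \<open>nat\<close>; fibres are nonempty, so distinct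
    elements have distinct fibres.\<close>
  define f where "f = (\<lambda>x. {u \<in> carrier (F 0). e (cl 0 u) = x})"
  have "\<exists>u\<in>carrier (F 0). e (cl 0 u) = x" if "x \<in> carrier M" for x
    using that P.e_surj cl_surj[of 0] by (metis imageE restrict_scalars_simps(1))
  then have f: "inj_on f (carrier ?M)"
    unfolding f_def by (auto intro!: inj_onI)
  define M' where "M' = map_module f ?M"
  have M_module: "module R ?M" by (rule restrict_scalars_module[OF P.M_module])
  obtain J :: "(nat \<Rightarrow> 'a) \<times> (nat \<Rightarrow> 'a) \<Rightarrow> ('a, (nat \<Rightarrow> 'a) set) res_carrier" where J: "inj J"
    using ex_inj_pair_to_list_fun by blast
  have Jon: "inj_on J A" for A using J by (rule inj_on_subset) simp
  have JG: "fg_projective R (map_module J (G i))" for i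
    by (rule fg_projective_map_module[OF G_fg_projective Jon])
  have FPR: "M' \<in> FPR R"
    unfolding FPR_def M'_def
    using map_resolution[OF G_resolution J f] fg_projective_imp_projective[OF JG] fg_projective_imp_fin_gen[OF JG]
    by blast
  define g where "g = inv_into (carrier ?M) f"
  have g: "g \<in> module_hom R M' ?M" "inj_on g (carrier M')" "g ` carrier M' = carrier ?M"
    using module_hom_map_module_inv[OF M_module f] f
    by (auto simp: g_def M'_def inj_on_inv_into)
  have short: "\<exists>n\<le>m. \<exists>(Q :: nat \<Rightarrow> ('a, ('a, (nat \<Rightarrow> 'a) set) res_carrier) module) d' e'.
      finite_resolution R n Q d' e' ?M \<and> (\<forall>i. projective R (Q i))" if "pd R M' \<le> enat m"
    using that resolution_iso[OF _ M_module g] unfolding pd_le_iff by blast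
  show thesis
  proof (rule that[OF FPR])
    show "carrier M = {\<zero>\<^bsub>M\<^esub>}" if "pd R M' \<le> enat m" "m = 0"
      using short[OF that(1)] projective_imp_zero that(2) by blast
    show "\<exists>s\<in>module_hom S (P k) (P k). (\<forall>x\<in>carrier (P k). s x \<in> cycles P d e M k) \<and>
         (\<forall>x\<in>cycles P d e M k. s x = x)" if "pd R M' \<le> enat m" "m = Suc k" for k
      using short[OF that(1)] short_resolution_imp_split[OF _ _ that(2)] by metis
  qed
qed

text \<open>Supplies the module \<open>S\<close> over itself for the case where fPD(S) is
  zero.\<close>

lemma free_resolution_rank_one:
  assumes "cring S"
  shows "finite_resolution S 0 (\<lambda>i. free_module S {..<if i = 0 then 1 else 0 :: nat})
     (\<lambda>i x. (\<lambda>_. \<zero>\<^bsub>S\<^esub>)) (\<lambda>x. x) (free_module S {..<1})"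
    (is "finite_resolution S 0 ?P ?d ?e ?M")
proof -
  interpret S: cring S by fact
  have zero: "carrier (?P (Suc i)) = {\<lambda>_. \<zero>\<^bsub>S\<^esub>}" for i
    by (auto simp: mem_free_module fun_eq_iff)
  have "(\<lambda>_. \<zero>\<^bsub>S\<^esub>) \<in> carrier (?P i)" for i by (simp add: mem_free_module)
  then have "?d j ` carrier (?P (Suc j)) = cycles ?P ?d ?e ?M j" for j
    unfolding zero by (cases j) (auto simp only: cycles_simps zero free_module_simps)
  moreover have "?d i \<in> module_hom S (?P (Suc i)) (?P i)" for i
    using module_hom_const_zero[OF free_module_module[OF assms],
        of "{..<if i = 0 then 1 else 0 :: nat}" "?P (Suc i)"] by simp
  moreover have "carrier (?P i) = {\<zero>\<^bsub>?P i\<^esub>}" if "0 < i" for i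
    using zero that by (cases i) auto
  ultimately show ?thesis
    unfolding finite_resolution_iff
    by (intro conjI allI impI) (simp_all add: free_module_module[OF assms] module_hom_id)
qed

lemma regular_quotient_PIdl:
  fixes R :: "('a, 'r) ring_scheme"
  assumes "cring R" "a \<in> carrier R" "\<not> zero_divisor R a"
  shows "regular_quotient R (R Quot (PIdl\<^bsub>R\<^esub> a)) (\<lambda>r. PIdl\<^bsub>R\<^esub> a +>\<^bsub>R\<^esub> r) a"
proof -
  interpret R: cring R by fact
  let ?I = "PIdl\<^bsub>R\<^esub> a"
  interpret I: ideal ?I R by (rule R.cgenideal_ideal[OF assms(2)])
  show ?thesis
  proof (rule regular_quotient.intro)
    show "cring R" by fact
    show "cring (R Quot ?I)" by (rule I.quotient_is_cring[OF assms(1)])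
    show "(\<lambda>r. ?I +>\<^bsub>R\<^esub> r) \<in> ring_hom R (R Quot ?I)" by (rule I.rcos_ring_hom)
    show "(\<lambda>r. ?I +>\<^bsub>R\<^esub> r) ` carrier R = carrier (R Quot ?I)"
      by (auto simp: FactRing_def A_RCOSETS_def')
    show "a \<in> carrier R" by fact
    fix r assume r: "r \<in> carrier R"
    have "?I +>\<^bsub>R\<^esub> r = ?I \<longleftrightarrow> r \<in> ?I"
      using I.a_rcos_self[OF r] I.a_rcos_const[of r] by auto
    also have "r \<in> ?I \<longleftrightarrow> (\<exists>s\<in>carrier R. r = s \<otimes>\<^bsub>R\<^esub> a)"
      unfolding cgenideal_def by blast
    also have "\<dots> \<longleftrightarrow> (\<exists>s\<in>carrier R. r = a \<otimes>\<^bsub>R\<^esub> s)"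
      by (rule bex_cong[OF refl]) (simp only: R.m_comm[OF assms(2)])
    finally show "?I +>\<^bsub>R\<^esub> r = \<zero>\<^bsub>R Quot ?I\<^esub> \<longleftrightarrow> (\<exists>s\<in>carrier R. r = a \<otimes>\<^bsub>R\<^esub> s)"
      by (simp add: FactRing_def)
    show "r = \<zero>\<^bsub>R\<^esub>" if "a \<otimes>\<^bsub>R\<^esub> r = \<zero>\<^bsub>R\<^esub>"
      using assms(2,3) r that by (auto simp: zero_divisor_def)
  qed
qed

theorem theorem3p3:
  fixes R :: "('a, 'r) ring_scheme" and a :: 'a
  assumes "cring R"
    and "a \<in> carrier R"
    and "\<not> zero_divisor R a"
    and "a \<notin> Units R"
    and "fPD (R Quot (PIdl\<^bsub>R\<^esub> a)) < \<infinity>"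
  shows "fPD R \<ge> fPD (R Quot (PIdl\<^bsub>R\<^esub> a)) + 1"
proof -
  let ?S = "R Quot (PIdl\<^bsub>R\<^esub> a)" and ?q = "\<lambda>r. PIdl\<^bsub>R\<^esub> a +>\<^bsub>R\<^esub> r"
  have quot: "regular_quotient R ?S ?q a" by (rule regular_quotient_PIdl[OF assms(1-3)])
  interpret regular_quotient R ?S ?q a by (rule quot)
  obtain m where m: "fPD ?S = enat m" using assms(5) by (cases "fPD ?S") auto
  have "\<exists>M' :: ('a, (nat \<Rightarrow> 'a) set) module. M' \<in> FPR R \<and> \<not> pd R M' \<le> enat m"
  proof (cases m)
    case 0
    let ?P = "\<lambda>i. free_module ?S {..<if i = 0 then 1 else 0 :: nat}"
    \<comment> \<open>The nonunit hypothesis enters here: if 1 were in \<open>aR\<close>, then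
      \<open>a\<close> would be invertible. A nonzero rank one module excludes dimension 0 over
      \<open>R\<close>.\<close>
    have "\<one>\<^bsub>?S\<^esub> \<noteq> \<zero>\<^bsub>?S\<^esub>"
    proof
      assume "\<one>\<^bsub>?S\<^esub> = \<zero>\<^bsub>?S\<^esub>"
      then obtain s where "s \<in> carrier R" "\<one>\<^bsub>R\<^esub> = a \<otimes>\<^bsub>R\<^esub> s"
        using q_kernel[of "\<one>\<^bsub>R\<^esub>"] ring_hom_one[OF q_ring_hom] by auto
      then show False using assms(2,4) R.m_comm by (auto simp: Units_def)
    qed
    then have "unit_vec ?S 0 \<noteq> (\<lambda>_::nat. \<zero>\<^bsub>?S\<^esub>)" by (metis unit_vec_def)
    then have "carrier (free_module ?S {..<1::nat}) \<noteq> {\<zero>\<^bsub>free_module ?S {..<1::nat}\<^esub>}"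
      using unit_vec_mem[OF S_cring, of 0 "{..<1::nat}"] by auto
    then show ?thesis
      using change_of_rings[OF quot free_resolution_rank_one[OF S_cring]] fg_projective_free[OF S_cring] 0
      by metis
  next
    case (Suc k)
    \<comment> \<open>If all dimensions were at most \<open>k\<close>, so would be their supremum
      \<open>m = Suc k\<close>; hence the supremum is attained.\<close>
    obtain M :: "('a set, (nat \<Rightarrow> 'a set) set) module" where M: "M \<in> FPR ?S" "\<not> pd ?S M \<le> enat k"
    proof (rule ccontr)
      assume "\<not> thesis"
      then have "fPD ?S \<le> enat k" using that unfolding fPD_def by (intro SUP_least) blast
      then show False using m Suc by simp
    qed
    have "pd ?S M \<le> enat m" using M(1) m unfolding fPD_def by (metis SUP_upper)
    then obtain l d' e' and Q :: "nat \<Rightarrow> ('a set, ('a set, (nat \<Rightarrow> 'a set) set) res_carrier) module"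
      where Q: "l \<le> m" "finite_resolution ?S l Q d' e' M" "\<And>i. projective ?S (Q i)"
      unfolding pd_le_iff by blast
    from M(1) obtain n P d e where
        P: "finite_resolution ?S n (P :: nat \<Rightarrow> ('a set, ('a set, (nat \<Rightarrow> 'a set) set) res_carrier) module) d e M"
        "\<forall>i\<le>n. projective ?S (P i) \<and> fin_gen ?S (P i)"
      unfolding FPR_def by blast
    note P_fg = fg_projective_all[OF P]
    \<comment> \<open>\<open>Q\<close> is short but its terms need not be finitely generated;
      \<open>P\<close> is finitely generated but of unknown length \<open>n\<close>. Comparison with
      \<open>Q\<close> splits the cycles of \<open>P\<close> in degree \<open>m\<close>, and cutting
      there keeps finite generation.\<close>
    obtain P' :: "nat \<Rightarrow> ('a set, ('a set, (nat \<Rightarrow> 'a set) set) res_carrier) module" and d'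
      where P': "finite_resolution ?S m P' d' e M" "\<And>i. fg_projective ?S (P' i)"
      using cycles_retract[OF P(1) fg_projective_imp_projective[OF P_fg] Q(2,3,1)]
        truncate_resolution[OF P(1) P_fg] by metis
    obtain M' :: "('a, (nat \<Rightarrow> 'a) set) module" where M': "M' \<in> FPR R"
      "pd R M' \<le> enat m \<Longrightarrow>
       \<exists>s\<in>module_hom ?S (P' k) (P' k). (\<forall>x\<in>carrier (P' k). s x \<in> cycles P' d' e M k) \<and>
         (\<forall>x\<in>cycles P' d' e M k. s x = x)"
      using change_of_rings[OF quot P'] Suc by metis
    \<comment> \<open>The splitting over \<open>S\<close> allows \<open>P'\<close> to be cut once
      more, in degree \<open>k\<close>, against the choice of \<open>M\<close>.\<close>
    have "\<not> pd R M' \<le> enat m"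
    proof
      assume "pd R M' \<le> enat m"
      then obtain P'' :: "nat \<Rightarrow> ('a set, ('a set, (nat \<Rightarrow> 'a set) set) res_carrier) module" and d''
        where "finite_resolution ?S k P'' d'' e M" "\<And>i. fg_projective ?S (P'' i)"
        using M'(2) truncate_resolution[OF P'] by metis
      then have "pd ?S M \<le> enat k"
        unfolding pd_le_iff using fg_projective_imp_projective by blast
      then show False using M(2) by simp
    qed
    then show ?thesis using M'(1) by blast
  qed
  then obtain M' :: "('a, (nat \<Rightarrow> 'a) set) module" where M': "M' \<in> FPR R" "\<not> pd R M' \<le> enat m"
    by blast
  then have "enat m + 1 \<le> pd R M'" by (cases "pd R M'") (auto simp: one_enat_def)
  also have "\<dots> \<le> fPD R" unfolding fPD_def by (rule SUP_upper[OF M'(1)])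
  finally show ?thesis using m by simp
qed

end
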